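(* Let $X=(x_{i,j})$ be a generic $m\times n$ matrix, regarded as consisting of two blocks, $X=(A\,B)$, where $A$ has size $m\times a$ and $B$ has size $m\times(n-a)$. Fix the ring $R=k[X]=k[x_{i,j}]$, where every entry of $A$ has degree $p$ and every entry of $B$ has degree $q>p$; that is, $\deg(x_{i,j})=p$ if $1\le j\le a$ and $\deg(x_{i,j})=q$ otherwise. Fix $t$ and $d$. Let $I_t(X)_{\le d}$ be the ideal generated by those $t$-minors of $X$ of degree less than or equal to $d$, and for each $r$ let $I_r(A)$ be the ideal generated by the $r$-minors of $A$. Then $$I_t(X)_{\le d}=I_t(X)\cap I_r(A)\qquad\text{for } r=\left\lceil\frac{tq-d}{q-p}\right\rceil .$$
   Context: Here $k$ is a field. A generic matrix is one whose entries $x_{i,j}$ are independent variables over the base ring. A $t$-minor of a matrix is the determinant of a $t\times t$ submatrix, given by a choice of $t$ distinct rows and $t$ distinct columns. $I_t(X)$ is the ideal generated by all $t$-minors of $X$. All ideals are ideals of $R$.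
   Formalization: The formal statement assumes r ≤ t or r > min(m,a), since for t < r ≤ min(m,a) the left side is 0 while the right side is I_r(A) ≠ 0 (e.g. m=n=a=2, t=1, p=1, q=2, d=0); for r ≤ 0, I_r(A) is read as the unit ideal. *)

theory Defs
  imports
    "HOL-Library.Poly_Mapping"
    "HOL-Algebra.Ideal"
    "Jordan_Normal_Form.Determinant"
    "Jordan_Normal_Form.DL_Submatrix"
begin

text \<open>
  Polynomials in the variables \<open>x i j\<close> with \<open>i j :: nat\<close> are finitely supported maps from
  monomials (exponent vectors) to coefficients, multiplied by convolution.  The polynomial ring of
  an \<open>m \<times> n\<close> generic matrix is the subring of those in which only \<open>x i j\<close> with
  \<open>i < m\<close> and \<open>j < n\<close> occur.  Row and column indices start at 0.
\<close>

type_synonym monomial = "(nat \<times> nat) \<Rightarrow>\<^sub>0 nat"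
type_synonym 'k polynomial = "monomial \<Rightarrow>\<^sub>0 'k"

definition var :: "nat \<Rightarrow> nat \<Rightarrow> 'k::field polynomial" where
  "var i j = Poly_Mapping.single (Poly_Mapping.single (i, j) 1) 1"

definition poly_ring :: "nat \<Rightarrow> nat \<Rightarrow> 'k::field polynomial ring" where
  "poly_ring m n =
    \<lparr>carrier = {f. \<forall>u \<in> Poly_Mapping.keys f. Poly_Mapping.keys u \<subseteq> {..<m} \<times> {..<n}},
     monoid.mult = (*), one = 1, zero = 0, add = (+)\<rparr>"

definition generic_mat :: "nat \<Rightarrow> nat \<Rightarrow> 'k::field polynomial mat" where
  "generic_mat m n = mat m n (\<lambda>(i, j). var i j)"

definition minors :: "nat \<Rightarrow> 'r::comm_ring_1 mat \<Rightarrow> 'r set" where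
  "minors t M = {det (submatrix M I J) | I J.
     I \<subseteq> {..<dim_row M} \<and> card I = t \<and> J \<subseteq> {..<dim_col M} \<and> card J = t}"

text \<open>
  The matrix \<open>M\<close> need not involve all variables of the ring \<open>R\<close>; the ideal is taken in \<open>R\<close>.
  The determinant of the empty matrix is 1, so for \<open>t = 0\<close> this is the unit ideal.
\<close>

definition det_ideal :: "'r::comm_ring_1 ring \<Rightarrow> nat \<Rightarrow> 'r mat \<Rightarrow> 'r set" where
  "det_ideal R t M = genideal R (minors t M)"

definition monomial_degree :: "(nat \<times> nat \<Rightarrow> int) \<Rightarrow> monomial \<Rightarrow> int" where
  "monomial_degree w u = (\<Sum>v\<in>Poly_Mapping.keys u. int (Poly_Mapping.lookup u v) * w v)"

text \<open>
  The value at the zero polynomial is unspecified; minors of a generic matrix are nonzero.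
\<close>

definition poly_degree :: "(nat \<times> nat \<Rightarrow> int) \<Rightarrow> 'k::field polynomial \<Rightarrow> int" where
  "poly_degree w f = Max (monomial_degree w ` Poly_Mapping.keys f)"

definition block_degree :: "nat \<Rightarrow> int \<Rightarrow> int \<Rightarrow> nat \<times> nat \<Rightarrow> int" where
  "block_degree a p q = (\<lambda>(i, j). if j < a then p else q)"

definition det_ideal_le ::
    "'k::field polynomial ring \<Rightarrow> (nat \<times> nat \<Rightarrow> int) \<Rightarrow> nat \<Rightarrow> int \<Rightarrow> 'k polynomial mat \<Rightarrow> 'k polynomial set" where
  "det_ideal_le R w t d M = genideal R {f \<in> minors t M. poly_degree w f \<le> d}"

lemma poly_ring_simps [simp]:
  "monoid.mult (poly_ring m n) = (*)" "one (poly_ring m n) = 1"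
  "zero (poly_ring m n) = 0" "add (poly_ring m n) = (+)"
  by (simp_all add: poly_ring_def)

lemma poly_ring_carrier:
  "f \<in> carrier (poly_ring m n) \<longleftrightarrow>
    (\<forall>u \<in> Poly_Mapping.keys f. Poly_Mapping.keys u \<subseteq> {..<m} \<times> {..<n})"
  by (simp add: poly_ring_def)

lemma poly_ring_add:
  "f \<in> carrier (poly_ring m n) \<Longrightarrow> g \<in> carrier (poly_ring m n) \<Longrightarrow> f + g \<in> carrier (poly_ring m n)"
  unfolding poly_ring_carrier using Poly_Mapping.keys_add[of f g] by blast

lemma poly_ring_mult:
  assumes "f \<in> carrier (poly_ring m n)" "g \<in> carrier (poly_ring m n)"
  shows "f * g \<in> carrier (poly_ring m n)"
  unfolding poly_ring_carrier
proof
  fix u assume "u \<in> Poly_Mapping.keys (f * g)"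
  then obtain v w where "u = v + w" "v \<in> Poly_Mapping.keys f" "w \<in> Poly_Mapping.keys g"
    using keys_mult[of f g] by blast
  then show "Poly_Mapping.keys u \<subseteq> {..<m} \<times> {..<n}"
    using assms Poly_Mapping.keys_add[of v w] unfolding poly_ring_carrier by blast
qed

lemma poly_ring_uminus:
  "f \<in> carrier (poly_ring m n) \<Longrightarrow> - f \<in> carrier (poly_ring m n)"
  by (simp add: poly_ring_carrier)

lemma poly_ring_zero: "0 \<in> carrier (poly_ring m n)"
  by (simp add: poly_ring_carrier)

lemma poly_ring_one: "1 \<in> carrier (poly_ring m n)"
  by (simp add: poly_ring_carrier)

lemma cring_poly_ring: "cring (poly_ring m n :: 'k::field polynomial ring)"
proof (rule cringI)
  show "abelian_group (poly_ring m n :: 'k polynomial ring)"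
  proof (rule abelian_groupI)
    fix f :: "'k polynomial" assume "f \<in> carrier (poly_ring m n)"
    then show "\<exists>g\<in>carrier (poly_ring m n). g \<oplus>\<^bsub>poly_ring m n\<^esub> f = \<zero>\<^bsub>poly_ring m n\<^esub>"
      by (intro bexI[of _ "- f"]) (simp_all add: poly_ring_uminus)
  qed (simp_all add: poly_ring_add poly_ring_zero add.assoc add.commute)
  show "comm_monoid (poly_ring m n :: 'k polynomial ring)"
    by (rule comm_monoidI) (simp_all add: poly_ring_mult poly_ring_one mult.assoc mult.commute)
qed (simp add: distrib_right)

lemma var_in_carrier: "i < m \<Longrightarrow> j < n \<Longrightarrow> var i j \<in> carrier (poly_ring m n)"
  by (simp add: var_def poly_ring_carrier)

end

theory Submission
  imports Defs "HOL-Computational_Algebra.Polynomial_Factorial"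
begin

text \<open>
  Every \<open>t\<close>-minor of \<open>X\<close> is homogeneous, and its degree is \<open>t q - s (q - p)\<close> when \<open>s\<close> of its
  columns lie in \<open>A\<close>.  So the minors of degree at most \<open>d\<close> are those with at least \<open>r\<close> columns in
  \<open>A\<close>.  One inclusion is then Laplace expansion along \<open>r\<close> of these columns.  For the other one,
  an element of \<open>I\<^sub>t(X) \<inter> I\<^sub>r(A)\<close> has to be rewritten in terms of the few minors that
  satisfy both conditions at once, and the tool is standard monomial theory.

  Append an identity matrix to \<open>X\<close>.  Up to sign, the minors of \<open>X\<close> of all sizes are the maximal
  minors (brackets) of the \<open>m \<times> (n + m)\<close> matrix \<open>(X | 1)\<close> (\<open>minor_eq_bracket\<close>).  In particular
  the variables are, so a polynomial is a \<open>k\<close>-linear combination of products of brackets.  Such a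
  product is written as a tableau, whose rows are \<open>m\<close>-element sets of columns.  Order the rows by \<open>precedes C D\<close>: the \<open>i\<close>-th smallest element of \<open>C\<close> is at most
  the \<open>i\<close>-th smallest element of \<open>D\<close>.  A tableau is standard if its rows are weakly increasing.

  The conditions that a bracket has at least \<open>t\<close> columns in \<open>X\<close>, and at least \<open>r\<close> columns in \<open>A\<close>,
  each cut out a downward closed set \<open>\<Omega>\<close> of rows, because the columns of \<open>A\<close> come first and those of
  the identity matrix last.  Three facts finish the argument.

  \<^item> The straightening law (\<open>straightening\<close>): a product of brackets whose first row lies in \<open>\<Omega>\<close> is a
    combination of standard ones with the same property.  It follows from the quadratic exchange
    relation \<open>bracket_exchange\<close>.

  \<^item> The standard products of a fixed length are linearly independent
    (\<open>standard_bracket_monomials_independent\<close>).  For a generic \<open>m \<times> (n + m)\<close> matrix this is visible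
    from leading terms: the product of the diagonals of the rows determines a standard tableau.
    A relation for \<open>(X | 1)\<close> becomes one for the generic matrix \<open>(Y\<^sub>1 | Y\<^sub>2)\<close> by substituting
    the inverse of \<open>Y\<^sub>2\<close> times \<open>Y\<^sub>1\<close> for \<open>X\<close>.

  \<^item> Hence the spans belonging to \<open>\<Omega>\<^sub>1\<close> and \<open>\<Omega>\<^sub>2\<close> intersect in the span belonging to
    \<open>\<Omega>\<^sub>1 \<inter> \<Omega>\<^sub>2\<close> (\<open>tableau_ideal_Int\<close>).  For the two conditions above, a bracket in the
    intersection is expanded along its first \<open>t\<close> columns.  These lie in \<open>X\<close>, and the first \<open>r\<close> of them
    lie in \<open>A\<close> since \<open>r \<le> t\<close>; so each term contains a \<open>t\<close>-minor with at least \<open>r\<close> columns in \<open>A\<close>.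

  In the remaining case \<open>r > min m a\<close> there is no \<open>r\<close>-minor of \<open>A\<close>, and both sides vanish.
\<close>

section \<open>Determinants by Laplace expansion\<close>

text \<open>
  The determinant with rows \<open>rs\<close>, a list, and columns \<open>C\<close> in increasing order, expanded along the
  first row.  Keeping the columns as a set makes the signs of the generalised Laplace expansion a
  count of inversions.  If \<open>C\<close> and \<open>rs\<close> differ in size the value is 0 (\<open>ldet_nonzero_card\<close>), so sums
  over subsets need no size restrictions.
\<close>

fun ldet :: "('i \<Rightarrow> nat \<Rightarrow> 'r::comm_ring_1) \<Rightarrow> 'i list \<Rightarrow> nat set \<Rightarrow> 'r" where
  "ldet F [] C = (if C = {} then 1 else 0)"
| "ldet F (r # rs) C = (\<Sum>j\<in>C. (-1) ^ card (C \<inter> {..<j}) * F r j * ldet F rs (C - {j}))"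

lemma ldet_cong:
  "(\<And>r c. r \<in> set rs \<Longrightarrow> c \<in> C \<Longrightarrow> F r c = G r c) \<Longrightarrow> ldet F rs C = ldet G rs C"
proof (induction rs arbitrary: C)
  case (Cons r rs)
  have "ldet F rs (C - {j}) = ldet G rs (C - {j})" for j
    by (rule Cons.IH) (use Cons.prems in auto)
  then show ?case using Cons.prems by (auto intro!: sum.cong)
qed simp

lemma ldet_nonzero_card:
  "ldet F rs C \<noteq> 0 \<Longrightarrow> finite C \<and> card C = length rs"
proof (induction rs arbitrary: C)
  case (Cons r rs)
  from Cons.prems have fin: "finite C" by (auto intro: ccontr)
  from Cons.prems obtain j where j: "j \<in> C" "ldet F rs (C - {j}) \<noteq> 0"
    by (metis (no_types, lifting) ldet.simps(2) mult_zero_right sum.neutral)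
  from Cons.IH[OF j(2)] j(1) fin show ?case
    by (metis card_Suc_Diff1 length_Cons)
qed (simp split: if_splits)

lemma ldet_zero_column:
  "c \<in> C \<Longrightarrow> (\<And>r. r \<in> set rs \<Longrightarrow> F r c = 0) \<Longrightarrow> ldet F rs C = 0"
proof (induction rs arbitrary: C)
  case (Cons r rs)
  have "(-1) ^ card (C \<inter> {..<j}) * F r j * ldet F rs (C - {j}) = 0" if "j \<in> C" for j
    by (cases "j = c") (use Cons in auto)
  then show ?case by (simp add: sum.neutral)
qed auto

lemma ldet_hom:
  assumes "h 0 = 0" "h 1 = 1" "\<And>x y. h (x + y) = h x + h y" "\<And>x y. h (x * y) = h x * h y"
  shows "h (ldet F rs C) = ldet (\<lambda>i j. h (F i j)) rs C"
proof (induction rs arbitrary: C)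
  case Nil then show ?case by (simp add: assms)
next
  case (Cons r rs)
  have hsum: "h (sum g A) = (\<Sum>a\<in>A. h (g a))" for g and A :: "nat set"
    by (induction A rule: infinite_finite_induct) (simp_all add: assms)
  have hneg: "h (- 1) = - 1"
    using assms(3)[of 1 "- 1"] by (simp add: assms eq_neg_iff_add_eq_0 add.commute)
  have hpow: "h ((- 1) ^ k) = (- 1) ^ k" for k
    by (induction k) (simp_all add: assms hneg del: mult_minus1 mult_minus_left)
  show ?case by (simp add: hsum assms hpow Cons.IH)
qed

definition inversions :: "nat set \<Rightarrow> nat set \<Rightarrow> nat" where
  "inversions S T = (\<Sum>s\<in>S. card (T \<inter> {..<s}))"

text \<open>
  Induction on \<open>rs1\<close>: choosing first the column \<open>j\<close> of the first row and then the columns \<open>S'\<close> of the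
  other rows in \<open>rs1\<close> is the same as choosing \<open>S = insert j S'\<close> and then \<open>j\<close> in \<open>S\<close>.  The signs agree
  because the elements of \<open>C\<close> below \<open>j\<close> split into those in \<open>S\<close> and those outside.
\<close>

theorem ldet_laplace:
  fixes F :: "'i \<Rightarrow> nat \<Rightarrow> 'r::comm_ring_1"
  assumes "finite C"
  shows "ldet F (rs1 @ rs2) C =
    (\<Sum>S\<in>Pow C. (-1) ^ inversions S (C - S) * ldet F rs1 S * ldet F rs2 (C - S))"
  using assms
proof (induction rs1 arbitrary: C)
  case Nil
  have "(\<Sum>S\<in>Pow C. (-1) ^ inversions S (C - S) * ldet F [] S * ldet F rs2 (C - S))
      = (\<Sum>S\<in>{{}}. (-1) ^ inversions S (C - S) * ldet F [] S * ldet F rs2 (C - S))"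
    by (rule sum.mono_neutral_right) (use Nil in auto)
  then show ?case by (simp add: inversions_def)
next
  case (Cons r rs1)
  let ?f = "\<lambda>j S'. (-1) ^ card (C \<inter> {..<j}) * F r j * ((-1) ^ inversions S' (C - {j} - S') *
              ldet F rs1 S' * ldet F rs2 (C - {j} - S'))"
  let ?g = "\<lambda>S j. (-1) ^ inversions S (C - S) *
              ((-1) ^ card (S \<inter> {..<j}) * F r j * ldet F rs1 (S - {j})) * ldet F rs2 (C - S)"
  have sign: "(-1) ^ card (C \<inter> {..<j}) * (-1) ^ inversions (S - {j}) (C - S)
      = (-1 :: 'r) ^ inversions S (C - S) * (-1) ^ card (S \<inter> {..<j})"
    if "S \<subseteq> C" "j \<in> S" for S j
  proof -
    have fS: "finite S" using that Cons.prems finite_subset by blast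
    have "C \<inter> {..<j} = (S \<inter> {..<j}) \<union> ((C - S) \<inter> {..<j})" using that by auto
    then have "card (C \<inter> {..<j}) = card (S \<inter> {..<j}) + card ((C - S) \<inter> {..<j})"
      by (metis (no_types, lifting) card_Un_disjoint Cons.prems finite_Diff finite_Int fS
          inf_assoc Diff_disjoint inf_bot_left inf_commute)
    moreover have "inversions S (C - S) = card ((C - S) \<inter> {..<j}) + inversions (S - {j}) (C - S)"
      using that fS by (simp add: inversions_def sum.remove)
    ultimately have "card (C \<inter> {..<j}) + inversions (S - {j}) (C - S)
        = inversions S (C - S) + card (S \<inter> {..<j})" by simp
    then show ?thesis by (metis power_add)
  qed
  have "ldet F ((r # rs1) @ rs2) C = (\<Sum>j\<in>C. \<Sum>S'\<in>Pow (C - {j}). ?f j S')"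
    using Cons by (simp add: sum_distrib_left)
  also have "\<dots> = (\<Sum>(j, S')\<in>(SIGMA j:C. Pow (C - {j})). ?f j S')"
    using Cons.prems by (intro sum.Sigma) auto
  also have "\<dots> = (\<Sum>(S, j)\<in>(SIGMA S:Pow C. S). ?g S j)"
  proof (rule sum.reindex_bij_witness[where
        i = "\<lambda>(S, j). (j, S - {j})" and j = "\<lambda>(j, S'). (insert j S', j)"])
    fix p assume "p \<in> (SIGMA j:C. Pow (C - {j}))"
    then obtain j S' where p: "p = (j, S')" "j \<in> C" "S' \<subseteq> C - {j}" by auto
    then have "j \<notin> S'" "C - {j} - S' = C - insert j S'" "insert j S' - {j} = S'" by auto
    then have sg: "(-1 :: 'r) ^ card (C \<inter> {..<j}) * (-1) ^ inversions S' (C - insert j S') =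
        (-1) ^ inversions (insert j S') (C - insert j S') * (-1) ^ card (S' \<inter> {..<j})"
      using sign[of "insert j S'" j] p by auto
    have sg': "(-1 :: 'r) ^ card (C \<inter> {..<j}) * ((-1) ^ inversions S' (C - insert j S') * x) =
        (-1) ^ inversions (insert j S') (C - insert j S') * ((-1) ^ card (S' \<inter> {..<j}) * x)" for x
      using sg by (simp add: mult.assoc[symmetric])
    have "insert j S' \<inter> {..<j} = S' \<inter> {..<j}" by auto
    with \<open>C - {j} - S' = C - insert j S'\<close> \<open>insert j S' - {j} = S'\<close>
    show "(case case p of (j, S') \<Rightarrow> (insert j S', j) of (S, j) \<Rightarrow> ?g S j) =
        (case p of (j, S') \<Rightarrow> ?f j S')"
      using sg'[of "F r j * (ldet F rs1 S' * ldet F rs2 (C - insert j S'))"] p by (simp add: mult_ac)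
  qed auto
  also have "\<dots> = (\<Sum>S\<in>Pow C. \<Sum>j\<in>S. ?g S j)"
    using Cons.prems by (intro sum.Sigma[symmetric]) (auto intro: finite_subset)
  finally show ?case
    by (simp add: sum_distrib_left sum_distrib_right)
qed

lemma sorted_list_of_set_remove_nth:
  fixes C :: "nat set"
  assumes "finite C" "j < card C"
  defines "c \<equiv> sorted_list_of_set C ! j"
  shows "sorted_list_of_set (C - {c}) = take j (sorted_list_of_set C) @ drop (Suc j) (sorted_list_of_set C)"
    and "card (C \<inter> {..<c}) = j" and "c \<in> C"
proof -
  let ?l = "sorted_list_of_set C"
  have len: "j < length ?l" using assms by simp
  have l: "?l = take j ?l @ c # drop (Suc j) ?l" using len by (simp add: c_def id_take_nth_drop)
  have ss: "sorted_wrt (<) ?l" by simp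
  have ss': "sorted_wrt (<) (take j ?l @ c # drop (Suc j) ?l)" using ss l by metis
  have lt: "x < c" if "x \<in> set (take j ?l)" for x
    using ss' that by (simp add: sorted_wrt_append)
  have gt: "x > c" if "x \<in> set (drop (Suc j) ?l)" for x
    using ss' that by (simp add: sorted_wrt_append)
  have setl: "C = set (take j ?l) \<union> insert c (set (drop (Suc j) ?l))"
    using l by (metis assms(1) set_append list.simps(15) set_sorted_list_of_set)
  show "c \<in> C" using setl by auto
  have "set (take j ?l @ drop (Suc j) ?l) = C - {c}"
    using setl lt gt by fastforce
  moreover have "sorted_wrt (<) (take j ?l @ drop (Suc j) ?l)"
    using ss' by (simp add: sorted_wrt_append)
  ultimately show "sorted_list_of_set (C - {c}) = take j ?l @ drop (Suc j) ?l"
    by (metis assms(1) finite_Diff sorted_list_of_set.idem_if_sorted_distinct strict_sorted_iff)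
  have "C \<inter> {..<c} = set (take j ?l)" using setl lt gt by fastforce
  then show "card (C \<inter> {..<c}) = j"
    using len by (simp add: distinct_card)
qed

lemma ldet_eq_det:
  assumes "finite C" "card C = length rs"
  shows "ldet F rs C = det (mat (length rs) (length rs) (\<lambda>(i, j). F (rs ! i) (sorted_list_of_set C ! j)))"
  using assms
proof (induction rs arbitrary: C)
  case Nil
  then show ?case by simp
next
  case (Cons r rs)
  let ?n = "length (r # rs)" and ?l = "sorted_list_of_set C"
  let ?A = "mat ?n ?n (\<lambda>(i, j). F ((r # rs) ! i) (?l ! j))"
  have "det ?A = (\<Sum>j<?n. ?A $$ (0, j) * cofactor ?A 0 j)"
    by (rule laplace_expansion_row) auto
  also have "\<dots> = (\<Sum>j<?n. (-1) ^ card (C \<inter> {..<?l ! j}) * F r (?l ! j) * ldet F rs (C - {?l ! j}))"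
  proof (rule sum.cong[OF refl])
    fix j assume "j \<in> {..<?n}"
    then have j: "j < ?n" and jC: "j < card C" using Cons.prems by auto
    note rem = sorted_list_of_set_remove_nth[OF Cons.prems(1) jC]
    have "mat_delete ?A 0 j = mat (length rs) (length rs)
        (\<lambda>(i, j'). F (rs ! i) (sorted_list_of_set (C - {?l ! j}) ! j'))"
      unfolding rem(1) using j Cons.prems
      by (intro eq_matI) (auto simp: mat_delete_def nth_append)
    moreover have "ldet F rs (C - {?l ! j}) = det (mat (length rs) (length rs)
        (\<lambda>(i, j'). F (rs ! i) (sorted_list_of_set (C - {?l ! j}) ! j')))"
      by (rule Cons.IH) (use Cons.prems rem(3) in simp_all)
    ultimately show "?A $$ (0, j) * cofactor ?A 0 j =
       (-1) ^ card (C \<inter> {..<?l ! j}) * F r (?l ! j) * ldet F rs (C - {?l ! j})"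
      using j rem(2) by (simp add: cofactor_def)
  qed
  also have "\<dots> = (\<Sum>c\<in>C. (-1) ^ card (C \<inter> {..<c}) * F r c * ldet F rs (C - {c}))"
  proof (rule sum.reindex_bij_betw)
    show "bij_betw (\<lambda>j. ?l ! j) {..<?n} C"
      using Cons.prems by (intro bij_betw_nth) auto
  qed
  finally show ?case by simp
qed

lemma ldet_transpose:
  assumes "finite I" "finite J" "card I = card J"
  shows "ldet F (sorted_list_of_set I) J = ldet (\<lambda>j i. F i j) (sorted_list_of_set J) I"
proof -
  let ?n = "card I" and ?i = "sorted_list_of_set I" and ?j = "sorted_list_of_set J"
  have "ldet F ?i J = det (mat ?n ?n (\<lambda>(i, j). F (?i ! i) (?j ! j)))"
    using assms by (simp add: ldet_eq_det)
  also have "\<dots> = det (transpose_mat (mat ?n ?n (\<lambda>(i, j). F (?i ! i) (?j ! j))))"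
    by (rule det_transpose[symmetric, of _ ?n]) simp
  also have "transpose_mat (mat ?n ?n (\<lambda>(i, j). F (?i ! i) (?j ! j))) =
      mat ?n ?n (\<lambda>(i, j). F (?i ! j) (?j ! i))"
    by (rule eq_matI) auto
  also have "det \<dots> = ldet (\<lambda>j i. F i j) ?j I"
    using assms by (simp add: ldet_eq_det)
  finally show ?thesis .
qed

lemma det_permute_columns:
  assumes "A \<in> carrier_mat n n" "p permutes {0..<n}"
  shows "det (mat n n (\<lambda>(i, j). A $$ (i, p j))) = signof p * det (A :: 'r::comm_ring_1 mat)"
proof -
  have "det (mat n n (\<lambda>(i, j). A $$ (i, p j))) = det (transpose_mat (mat n n (\<lambda>(i, j). A $$ (i, p j))))"
    by (rule det_transpose[symmetric, of _ n]) simp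
  also have "transpose_mat (mat n n (\<lambda>(i, j). A $$ (i, p j))) = mat n n (\<lambda>(i, j). transpose_mat A $$ (p i, j))"
  proof (rule eq_matI)
    fix i j assume "i < dim_row (mat n n (\<lambda>(i, j). transpose_mat A $$ (p i, j)))"
      "j < dim_col (mat n n (\<lambda>(i, j). transpose_mat A $$ (p i, j)))"
    moreover from this have "p i < n" using permutes_in_image[OF assms(2), of i] by simp
    ultimately show "transpose_mat (mat n n (\<lambda>(i, j). A $$ (i, p j))) $$ (i, j) =
      mat n n (\<lambda>(i, j). transpose_mat A $$ (p i, j)) $$ (i, j)"
      using assms(1) by auto
  qed auto
  also have "det \<dots> = signof p * det (transpose_mat A)"
    by (rule det_permute_rows) (use assms in auto)
  finally show ?thesis using det_transpose[OF assms(1)] by simp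
qed

text \<open>
  Pulling columns back along \<open>g\<close> permutes them if \<open>g\<close> is injective and repeats one otherwise.  Only
  the fact that the factor is a sign is used later, never which one.
\<close>

lemma ldet_relabel:
  assumes "finite C"
  shows "inj_on g C \<Longrightarrow>
      ldet (\<lambda>r c. F r (g c)) rs C = ldet F rs (g ` C) \<or> ldet (\<lambda>r c. F r (g c)) rs C = - ldet F rs (g ` C)"
    and "\<not> inj_on g C \<Longrightarrow> ldet (\<lambda>r c. F r (g c)) rs C = 0"
proof -
  let ?n = "length rs" and ?l = "sorted_list_of_set C"
  let ?A = "mat ?n ?n (\<lambda>(i, j). F (rs ! i) (g (?l ! j)))"
  have eq: "ldet (\<lambda>r c. F r (g c)) rs C = det ?A" if "card C = ?n"
    using ldet_eq_det[OF assms that, of "\<lambda>r c. F r (g c)"] by simp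
  {
    assume "\<not> inj_on g C"
    then obtain x y where xy: "x \<in> C" "y \<in> C" "x \<noteq> y" "g x = g y" by (auto simp: inj_on_def)
    show "ldet (\<lambda>r c. F r (g c)) rs C = 0"
    proof (cases "card C = ?n")
      case True
      obtain i j where ij: "i < ?n" "j < ?n" "?l ! i = x" "?l ! j = y"
        using xy assms True by (metis in_set_conv_nth length_sorted_list_of_set set_sorted_list_of_set)
      have "det ?A = 0"
      proof (rule det_identical_columns[of _ ?n i j])
        show "col ?A i = col ?A j" using ij xy by (intro eq_vecI) auto
      qed (use ij xy in auto)
      then show ?thesis using eq[OF True] by simp
    qed (use ldet_nonzero_card in blast)
  next
    assume inj: "inj_on g C"
    show "ldet (\<lambda>r c. F r (g c)) rs C = ldet F rs (g ` C) \<or> ldet (\<lambda>r c. F r (g c)) rs C = - ldet F rs (g ` C)"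
    proof (cases "card C = ?n")
      case False
      then have "card (g ` C) \<noteq> ?n" using inj by (simp add: card_image)
      then have "ldet (\<lambda>r c. F r (g c)) rs C = 0" "ldet F rs (g ` C) = 0"
        using False ldet_nonzero_card by blast+
      then show ?thesis by simp
    next
      case True
      let ?l' = "sorted_list_of_set (g ` C)"
      let ?B = "mat ?n ?n (\<lambda>(i, j). F (rs ! i) (?l' ! j))"
      have cardg: "card (g ` C) = ?n" using inj True by (simp add: card_image)
      have dl: "distinct (map g ?l)" using inj assms by (simp add: distinct_map)
      have "mset (map g ?l) = mset ?l'"
        using dl assms by (metis set_map set_sorted_list_of_set set_eq_iff_mset_eq_distinct
            distinct_sorted_list_of_set finite_imageI)
      then obtain p where "p permutes {..<length ?l'}" and pl: "permute_list p ?l' = map g ?l"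
        by (rule mset_eq_permutation)
      then have p: "p permutes {0..<?n}" using cardg by (simp add: atLeast0LessThan)
      have gl: "g (?l ! j) = ?l' ! p j" if "j < ?n" for j
        using pl that True cardg by (metis (no_types, lifting) length_map length_permute_list
            length_sorted_list_of_set nth_map permute_list_nth \<open>p permutes {..<length ?l'}\<close>)
      have "?A = mat ?n ?n (\<lambda>(i, j). ?B $$ (i, p j))"
      proof (rule eq_matI)
        fix i j assume "i < dim_row (mat ?n ?n (\<lambda>(i, j). ?B $$ (i, p j)))"
          "j < dim_col (mat ?n ?n (\<lambda>(i, j). ?B $$ (i, p j)))"
        moreover from this have "p j < ?n" using permutes_in_image[OF p, of j] by simp
        ultimately show "?A $$ (i, j) = mat ?n ?n (\<lambda>(i, j). ?B $$ (i, p j)) $$ (i, j)"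
          using gl by auto
      qed auto
      then have "det ?A = signof p * det ?B"
        using det_permute_columns[OF _ p, of ?B] by simp
      moreover have "det ?B = ldet F rs (g ` C)"
        using ldet_eq_det[of "g ` C" rs F] assms cardg by simp
      ultimately show ?thesis using eq[OF True]
        by (cases "evenperm p") (simp_all add: sign_def)
    qed
  }
qed

section \<open>The exchange relation between brackets\<close>

lemma ldet_map: "ldet F (map h rs) C = ldet (\<lambda>r. F (h r)) rs C"
  by (induction rs arbitrary: C) simp_all

lemma ldet_upt_eq_det:
  assumes "finite C" "card C = m"
  shows "ldet F [0..<m] C = det (mat m m (\<lambda>(i, j). F i (sorted_list_of_set C ! j)))"
  using ldet_eq_det[OF assms(1), of "[0..<m]" F] assms(2)
  by (simp only: length_upt diff_zero) (intro arg_cong[of _ _ det] eq_matI; simp)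

lemma ldet_matrix_mult:
  fixes G H :: "nat \<Rightarrow> nat \<Rightarrow> 'r::comm_ring_1"
  assumes "finite C" "card C = m"
  shows "ldet (\<lambda>i j. \<Sum>l<m. G i l * H l j) [0..<m] C = ldet G [0..<m] {..<m} * ldet H [0..<m] C"
proof -
  let ?l = "sorted_list_of_set C"
  let ?G = "mat m m (\<lambda>(i, l). G i l)" and ?H = "mat m m (\<lambda>(l, j). H l (?l ! j))"
  have "ldet G [0..<m] {..<m} = det (mat m m (\<lambda>(i, j). G i (sorted_list_of_set {..<m} ! j)))"
    by (rule ldet_upt_eq_det) auto
  also have "mat m m (\<lambda>(i, j). G i (sorted_list_of_set {..<m} ! j)) = ?G"
    by (rule eq_matI) (simp_all add: lessThan_atLeast0)
  finally have G: "ldet G [0..<m] {..<m} = det ?G" .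
  have "mat m m (\<lambda>(i, j). \<Sum>l<m. G i l * H l (?l ! j)) = ?G * ?H"
    by (rule eq_matI) (simp_all add: scalar_prod_def lessThan_atLeast0)
  then show ?thesis
    using det_mult[of ?G m ?H] by (simp add: G ldet_upt_eq_det[OF assms])
qed

text \<open>
  The row operation is left multiplication by a unitriangular matrix.
\<close>

lemma ldet_subtract_rows:
  fixes N :: "nat \<Rightarrow> nat \<Rightarrow> 'r::comm_ring_1"
  assumes "finite C" "card C = 2 * m"
  shows "ldet N [0..<2 * m] C = ldet (\<lambda>r l. if r < m then N r l else N r l - N (r - m) l) [0..<2 * m] C"
proof -
  let ?n = "2 * m" and ?l = "sorted_list_of_set C"
  define A where "A = mat ?n ?n (\<lambda>(i, j). N i (?l ! j))"
  define A' where "A' = mat ?n ?n (\<lambda>(i, j). if i < m then N i (?l ! j) else N i (?l ! j) - N (i - m) (?l ! j))"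
  define L :: "'r mat" where "L = mat ?n ?n (\<lambda>(i, k). if i = k then 1 else if i = k + m then - 1 else 0)"
  have "det L = prod_list (diag_mat L)"
    by (rule det_lower_triangular[of ?n]) (auto simp: L_def)
  also have "\<dots> = 1"
    unfolding prod_list_diag_prod by (rule prod.neutral) (auto simp: L_def)
  finally have detL: "det L = 1" .
  have "L * A = A'"
  proof (rule eq_matI)
    fix i j assume "i < dim_row A'" "j < dim_col A'"
    then have ij: "i < ?n" "j < ?n" by (simp_all add: A'_def)
    have "(L * A) $$ (i, j) = (\<Sum>k<?n. L $$ (i, k) * A $$ (k, j))"
      using ij by (simp add: L_def A_def scalar_prod_def lessThan_atLeast0)
    also have "\<dots> = (\<Sum>k<?n. (if k = i then A $$ (k, j) else 0) +
        (if k = i - m then if m \<le> i then - A $$ (k, j) else 0 else 0))"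
      by (rule sum.cong) (use ij in \<open>auto simp: L_def\<close>)
    also have "\<dots> = A' $$ (i, j)"
      using ij by (subst sum.distrib, subst (1 2) sum.delta) (auto simp: A_def A'_def)
    finally show "(L * A) $$ (i, j) = A' $$ (i, j)" .
  qed (simp_all add: L_def A_def A'_def)
  then have "det A' = det A"
    using det_mult[of L ?n A] detL by (simp add: L_def A_def)
  then show ?thesis by (simp add: A_def A'_def ldet_upt_eq_det[OF assms])
qed

text \<open>
  The matrix has two blocks of \<open>m\<close> rows, both copies of \<open>F\<close>, with the columns in \<open>Q\<close> deleted from
  the upper block and those in \<open>P\<close> from the lower one.  Subtracting the upper from the lower block
  leaves there only the columns in \<open>P \<union> Q\<close>, which are fewer than the \<open>m\<close> rows.
\<close>

lemma ldet_overlap_zero: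
  fixes F :: "nat \<Rightarrow> nat \<Rightarrow> 'r::comm_ring_1"
  assumes "finite C" "P \<subseteq> C" "Q \<subseteq> C" "P \<inter> Q = {}" "card P + card Q < m"
  shows "ldet (\<lambda>r l. if r < m then (if l \<in> Q then 0 else F r l)
                     else (if l \<in> P then 0 else F (r - m) l)) [0..<2 * m] C = 0"
    (is "ldet ?N _ C = 0")
proof (cases "card C = 2 * m")
  case True
  let ?N' = "\<lambda>r l. if r < m then ?N r l else ?N r l - ?N (r - m) l"
  have "ldet ?N [0..<2 * m] C = ldet ?N' [0..<2 * m] C"
    by (rule ldet_subtract_rows) fact+
  also have "\<dots> = ldet ?N' ([0..<m] @ [m..<2 * m]) C"
    using upt_add_eq_append[of 0 m m] by (simp only: mult_2)
  also have "\<dots> = 0"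
    unfolding ldet_laplace[OF assms(1)]
  proof (rule sum.neutral, rule ballI)
    fix S assume "S \<in> Pow C"
    have "ldet ?N' [m..<2 * m] (C - S) = 0"
    proof (cases "card (C - S) = m")
      case True
      have "finite (P \<union> Q)" using assms(1-3) finite_subset by blast
      then have "card (C - S) \<le> card P + card Q" if "C - S \<subseteq> P \<union> Q"
        using card_mono[OF _ that] card_Un_le[of P Q] by linarith
      then have "\<not> C - S \<subseteq> P \<union> Q" using True assms(5) by linarith
      then obtain c where "c \<in> C - S" "c \<notin> P" "c \<notin> Q" by auto
      then show ?thesis by (intro ldet_zero_column[of c]) auto
    next
      case False
      then have "card (C - S) \<noteq> length [m..<2 * m]" by simp
      then show ?thesis using ldet_nonzero_card by blast
    qed
    then show "(- 1) ^ inversions S (C - S) * ldet ?N' [0..<m] S * ldet ?N' [m..<2 * m] (C - S) = 0"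
      by simp
  qed
  finally show ?thesis .
next
  case False
  then have "card C \<noteq> length [0..<2 * m]" by simp
  then show ?thesis using ldet_nonzero_card by blast
qed

text \<open>
  For sets of equal size this is the componentwise order of their sorted listings.  The counting form
  avoids indexing, and both conditions on columns in the theorem are instances of it.
\<close>

definition precedes :: "nat set \<Rightarrow> nat set \<Rightarrow> bool" where
  "precedes C D \<longleftrightarrow> (\<forall>y. card (D \<inter> {..<y}) \<le> card (C \<inter> {..<y}))"

text \<open>
  This is Garnir's relation: if \<open>A\<close> has fewer elements below \<open>x\<close> than \<open>B\<close>, apply
  \<open>ldet_overlap_zero\<close> to the columns
  \<open>P\<close> = part of \<open>A\<close> below \<open>x\<close>, which stays in the first factor, \<open>Q\<close> = part of \<open>B\<close> from \<open>x\<close> on,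
  which stays in the second factor, and the remaining ones, which are distributed in all ways.
  The Laplace expansion contains the product for \<open>A\<close> and \<open>B\<close> with coefficient a sign; in every other
  nonzero term some elements of \<open>A\<close> that are at least \<open>x\<close> are replaced by elements of \<open>B\<close> below \<open>x\<close>,
  which makes the first factor strictly smaller.

  The conclusion is phrased with an arbitrary additive subgroup \<open>U\<close>, so that the relation can be
  used inside a longer product without writing out its terms.
\<close>

theorem bracket_exchange:
  fixes F :: "nat \<Rightarrow> nat \<Rightarrow> 'r::comm_ring_1"
  assumes A: "finite A" "card A = m" and B: "finite B" "card B = m" and not: "\<not> precedes A B"
    and zero: "0 \<in> U" and add: "\<And>x y. x \<in> U \<Longrightarrow> y \<in> U \<Longrightarrow> x + y \<in> U"
    and neg: "\<And>x. x \<in> U \<Longrightarrow> - x \<in> U"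
    and mem: "\<And>A' B'. \<lbrakk>A' \<subseteq> A \<union> B; B' \<subseteq> A \<union> B; card A' = m; card B' = m; precedes A' A;
        \<not> precedes A A'\<rbrakk> \<Longrightarrow> ldet F [0..<m] A' * ldet F [0..<m] B' \<in> U"
  shows "ldet F [0..<m] A * ldet F [0..<m] B \<in> U"
proof -
  from not obtain x where x: "card (A \<inter> {..<x}) < card (B \<inter> {..<x})"
    by (auto simp: precedes_def not_le)
  \<comment> \<open>Columns of \<open>A\<close> get even labels and columns of \<open>B\<close> odd ones, so that a column occurring in both
     sets counts twice; \<open>g\<close> recovers the column.\<close>
  define g :: "nat \<Rightarrow> nat" where "g l = l div 2" for l
  define A2 where "A2 = (\<lambda>c. 2 * c) ` A"
  define B2 where "B2 = (\<lambda>c. 2 * c + 1) ` B"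
  define P where "P = (\<lambda>c. 2 * c) ` (A \<inter> {..<x})"
  define Q where "Q = (\<lambda>c. 2 * c + 1) ` (B - {..<x})"
  let ?C = "A2 \<union> B2"
  define N where "N r l = (if r < m then (if l \<in> Q then 0 else F r (g l))
      else (if l \<in> P then 0 else F (r - m) (g l)))" for r l
  define top where "top S = ldet N [0..<m] S" for S
  define bot where "bot S = ldet N [m..<2 * m] S" for S
  define t where "t S = (-1) ^ inversions S (?C - S) * top S * bot (?C - S)" for S
  define br where "br S = ldet F [0..<m] S" for S
  have finC: "finite ?C" using A B by (simp add: A2_def B2_def)
  have disj: "A2 \<inter> B2 = {}" unfolding A2_def B2_def by (auto, presburger)
  have PA: "P \<subseteq> A2" and QB: "Q \<subseteq> B2" by (auto simp: A2_def B2_def P_def Q_def)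
  have cardA2: "card A2 = m" unfolding A2_def using A by (subst card_image) (auto simp: inj_on_def)
  have cardP: "card P = card (A \<inter> {..<x})" unfolding P_def by (subst card_image) (auto simp: inj_on_def)
  have cardQ: "card Q = m - card (B \<inter> {..<x})"
    unfolding Q_def using B by (subst card_image) (auto simp: inj_on_def card_Diff_subset_Int)
  have "card (B \<inter> {..<x}) \<le> m" using B card_mono[of B "B \<inter> {..<x}"] by auto
  then have PQ: "card P + card Q < m" using x cardP cardQ by simp
  have rows: "[m..<2 * m] = map (\<lambda>r. r + m) [0..<m]"
    by (simp add: map_add_upt mult_2)
  have top_eq: "top S = ldet (\<lambda>r l. F r (g l)) [0..<m] S" if "S \<inter> Q = {}" for S
    unfolding top_def by (rule ldet_cong) (use that in \<open>auto simp: N_def\<close>)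
  have bot_eq: "bot S = ldet (\<lambda>r l. F r (g l)) [0..<m] S" if "S \<inter> P = {}" for S
    unfolding bot_def rows ldet_map by (rule ldet_cong) (use that in \<open>auto simp: N_def\<close>)
  have split: "[0..<2 * m] = [0..<m] @ [m..<2 * m]"
    using upt_add_eq_append[of 0 m m] by (simp only: mult_2)
  have "ldet N [0..<2 * m] ?C = 0"
    unfolding N_def by (rule ldet_overlap_zero) (use finC PA QB disj PQ in auto)
  then have "(\<Sum>S\<in>Pow ?C. t S) = 0"
    unfolding split ldet_laplace[OF finC] t_def top_def bot_def .
  then have main: "t A2 = - (\<Sum>S\<in>Pow ?C - {A2}. t S)"
    using finC sum.remove[of "Pow ?C" A2 t] by (simp add: eq_neg_iff_add_eq_0)
  have sgn: "y \<in> U" if "x \<in> U" "y = x \<or> y = - x" for x y using that neg by auto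
  have pw: "(-1) ^ k * y = y \<or> (-1) ^ k * y = - y" for k :: nat and y :: 'r
    by (cases "even k") auto
  have "t S \<in> U" if S: "S \<in> Pow ?C - {A2}" for S
  proof (cases "t S = 0")
    case False
    then have nz: "top S \<noteq> 0" "bot (?C - S) \<noteq> 0" by (auto simp: t_def)
    then have fS: "finite S" and cS: "card S = m" and cS': "card (?C - S) = m"
      using ldet_nonzero_card[of N "[0..<m]" S] ldet_nonzero_card[of N "[m..<2 * m]" "?C - S"]
      by (simp_all add: top_def bot_def)
    have SQ: "S \<inter> Q = {}"
    proof (rule ccontr)
      assume "S \<inter> Q \<noteq> {}"
      then obtain c where "c \<in> S" "c \<in> Q" by auto
      then have "top S = 0"
        unfolding top_def by (intro ldet_zero_column[of c]) (auto simp: N_def)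
      with nz show False by simp
    qed
    have SP: "P \<subseteq> S"
    proof (rule ccontr)
      assume "\<not> P \<subseteq> S"
      then obtain c where "c \<in> P" "c \<in> ?C - S" using PA by auto
      then have "bot (?C - S) = 0"
        unfolding bot_def by (intro ldet_zero_column[of c]) (auto simp: N_def)
      with nz show False by simp
    qed
    have topS: "top S = ldet (\<lambda>r l. F r (g l)) [0..<m] S" using SQ by (rule top_eq)
    have botS: "bot (?C - S) = ldet (\<lambda>r l. F r (g l)) [0..<m] (?C - S)" using SP by (intro bot_eq) auto
    have injS: "inj_on g S" using nz(1) topS ldet_relabel(2)[OF fS] by metis
    have injS': "inj_on g (?C - S)" using nz(2) botS ldet_relabel(2)[of "?C - S"] finC by (metis finite_Diff)
    let ?A = "g ` S" and ?B = "g ` (?C - S)"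
    have gC: "g ` ?C \<subseteq> A \<union> B" by (auto simp: A2_def B2_def g_def)
    \<comment> \<open>Below \<open>x\<close> the new first row contains the old one; from \<open>x\<close> on it is contained in the old one.\<close>
    have low: "c \<in> ?A" if "c \<in> A" "c < x" for c
    proof -
      have "2 * c \<in> S" using that SP by (auto simp: P_def)
      then have "g (2 * c) \<in> ?A" by (rule imageI)
      then show ?thesis by (simp add: g_def)
    qed
    have high: "c \<in> A" if "c \<in> ?A" "x \<le> c" for c
    proof -
      from that obtain l where l: "l \<in> S" "c = g l" by auto
      with S have "l \<in> A2 \<or> l \<in> B2" by auto
      then show ?thesis
      proof
        assume "l \<in> B2"
        then obtain b where "b \<in> B" "l = 2 * b + 1" by (auto simp: B2_def)
        moreover from this l have "b = c" by (simp add: g_def)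
        ultimately have "l \<in> Q" using that by (auto simp: Q_def)
        then show ?thesis using SQ l by auto
      qed (use l in \<open>auto simp: A2_def g_def\<close>)
    qed
    have cA: "card ?A = m" using injS cS by (simp add: card_image)
    have cB: "card ?B = m" using injS' cS' by (simp add: card_image)
    have "precedes ?A A"
      unfolding precedes_def
    proof
      fix y
      show "card (A \<inter> {..<y}) \<le> card (?A \<inter> {..<y})"
      proof (cases "y \<le> x")
        case True
        then show ?thesis using low fS by (intro card_mono) auto
      next
        case False
        then have "card (?A - {..<y}) \<le> card (A - {..<y})"
          using high A by (intro card_mono) auto
        moreover have "card (A \<inter> {..<y}) + card (A - {..<y}) = m"
          using card_Int_Diff[of A] A by metis
        moreover have "card (?A \<inter> {..<y}) + card (?A - {..<y}) = m"
          using card_Int_Diff[of ?A] fS cA by (metis finite_imageI)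
        ultimately show ?thesis by linarith
      qed
    qed
    moreover have "\<not> precedes A ?A"
    proof -
      have "\<not> S \<subseteq> A2" using S cS cardA2 A by (metis A2_def DiffD2 card_subset_eq finite_imageI singletonI)
      \<comment> \<open>A label moved from \<open>B\<close> into the first row stands for a new column below \<open>x\<close>.\<close>
      then obtain l where l: "l \<in> S" "l \<in> B2" using S by auto
      then obtain c where c: "c \<in> B" "l = 2 * c + 1" by (auto simp: B2_def)
      have cx: "c < x" using l c SQ by (fastforce simp: Q_def)
      have "c \<notin> A"
      proof
        assume "c \<in> A"
        then have "2 * c \<in> S" using cx SP by (auto simp: P_def)
        moreover have "g (2 * c) = g l" by (simp add: g_def c)
        ultimately have "2 * c = l" using injS l by (metis inj_onD)
        then show False using c by presburger
      qed
      moreover have "c \<in> ?A" using l c by (force simp: g_def)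
      ultimately have "A \<inter> {..<x} \<subset> ?A \<inter> {..<x}" using low cx by auto
      then have "card (A \<inter> {..<x}) < card (?A \<inter> {..<x})"
        using fS by (intro psubset_card_mono) auto
      then show ?thesis by (auto simp: precedes_def not_le)
    qed
    ultimately have U: "br ?A * br ?B \<in> U"
      unfolding br_def using S gC cA cB by (intro mem) auto
    have "top S = br ?A \<or> top S = - br ?A"
      unfolding topS br_def by (rule ldet_relabel(1)[OF fS injS])
    moreover have "bot (?C - S) = br ?B \<or> bot (?C - S) = - br ?B"
      unfolding botS br_def by (rule ldet_relabel(1)[OF _ injS']) (use finC in auto)
    ultimately have "top S * bot (?C - S) = br ?A * br ?B \<or> top S * bot (?C - S) = - (br ?A * br ?B)"
      by auto
    with U have "top S * bot (?C - S) \<in> U" by (rule sgn)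
    moreover have "t S = top S * bot (?C - S) \<or> t S = - (top S * bot (?C - S))"
      using pw[of "inversions S (?C - S)" "top S * bot (?C - S)"] by (simp only: mult.assoc t_def)
    ultimately show ?thesis by (rule sgn)
  qed (use zero in simp)
  moreover have "sum h T \<in> U" if "\<And>S. S \<in> T \<Longrightarrow> h S \<in> U" for h and T :: "nat set set"
    using that by (induction T rule: infinite_finite_induct) (auto intro: zero add)
  ultimately have "(\<Sum>S\<in>Pow ?C - {A2}. t S) \<in> U" by blast
  then have U: "t A2 \<in> U" unfolding main by (rule neg)
  have C': "?C - A2 = B2" using disj by auto
  have gA: "g ` A2 = A" "inj_on g A2" by (auto simp: g_def A2_def image_image inj_on_def)
  have gB: "g ` B2 = B" "inj_on g B2" by (auto simp: g_def B2_def image_image inj_on_def)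
  have AQ: "top A2 = ldet (\<lambda>r l. F r (g l)) [0..<m] A2" using QB disj by (intro top_eq) blast
  have BP: "bot B2 = ldet (\<lambda>r l. F r (g l)) [0..<m] B2" using PA disj by (intro bot_eq) blast
  have "top A2 = br A \<or> top A2 = - br A"
    using ldet_relabel(1)[OF _ gA(2), of F "[0..<m]"] finC[unfolded finite_Un]
    unfolding gA(1) br_def AQ by blast
  moreover have "bot B2 = br B \<or> bot B2 = - br B"
    using ldet_relabel(1)[OF _ gB(2), of F "[0..<m]"] finC[unfolded finite_Un]
    unfolding gB(1) br_def BP by blast
  ultimately have brs: "br A * br B = top A2 * bot B2 \<or> br A * br B = - (top A2 * bot B2)"
    by auto
  have "t A2 = top A2 * bot B2 \<or> t A2 = - (top A2 * bot B2)"
    using pw[of "inversions A2 B2" "top A2 * bot B2"] by (simp only: mult.assoc t_def C')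
  then have "br A * br B = t A2 \<or> br A * br B = - t A2"
    using brs by auto
  with U have "br A * br B \<in> U" by (rule sgn)
  then show ?thesis by (simp add: br_def)
qed

section \<open>Straightening\<close>

lemma precedes_trans: "precedes C D \<Longrightarrow> precedes D E \<Longrightarrow> precedes C E"
  by (meson order_trans precedes_def)

definition tableaux :: "nat \<Rightarrow> nat \<Rightarrow> nat \<Rightarrow> nat set list set" where
  "tableaux m K N = {T. length T = N \<and> (\<forall>C\<in>set T. C \<subseteq> {..<K} \<and> card C = m)}"

definition standard :: "nat set list \<Rightarrow> bool" where
  "standard T \<longleftrightarrow> sorted_wrt precedes T"

definition bracket_monomial :: "(nat \<Rightarrow> nat \<Rightarrow> 'r::comm_ring_1) \<Rightarrow> nat \<Rightarrow> nat set list \<Rightarrow> 'r" where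
  "bracket_monomial F m T = (\<Prod>C\<leftarrow>T. ldet F [0..<m] C)"

definition order_ideal :: "nat set set \<Rightarrow> bool" where
  "order_ideal \<Omega> \<longleftrightarrow> (\<forall>C D. D \<in> \<Omega> \<longrightarrow> precedes C D \<longrightarrow> C \<in> \<Omega>)"

lemma finite_tableaux: "finite (tableaux m K N)"
proof (rule finite_subset)
  show "tableaux m K N \<subseteq> {T. set T \<subseteq> Pow {..<K} \<and> length T = N}" by (auto simp: tableaux_def)
  show "finite {T. set T \<subseteq> Pow {..<K} \<and> length T = N}" by (rule finite_lists_length_eq) simp
qed

text \<open>
  A strictly monotone measure for \<open>precedes\<close>; it makes the exchange process terminate.
\<close>

definition height :: "nat \<Rightarrow> nat set \<Rightarrow> nat" where
  "height K C = (\<Sum>y\<le>K. K - card (C \<inter> {..<y}))"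

lemma height_strict:
  assumes "C \<subseteq> {..<K}" "D \<subseteq> {..<K}" "precedes C D" "\<not> precedes D C"
  shows "height K C < height K D"
  unfolding height_def
proof (rule sum_strict_mono_ex1)
  show "\<forall>y\<in>{..K}. K - card (C \<inter> {..<y}) \<le> K - card (D \<inter> {..<y})"
    using assms(3) by (auto simp: precedes_def intro: diff_le_mono2)
  obtain y where y: "card (D \<inter> {..<y}) < card (C \<inter> {..<y})"
    using assms(4) by (auto simp: precedes_def not_le)
  \<comment> \<open>The summation range stops at \<open>K\<close>, beyond which the counts no longer change.\<close>
  define z where "z = min y K"
  have "C \<inter> {..<y} = C \<inter> {..<z}" "D \<inter> {..<y} = D \<inter> {..<z}"
    using assms(1,2) by (auto simp: z_def)
  then have "card (D \<inter> {..<z}) < card (C \<inter> {..<z})" using y by simp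
  moreover have "card (C \<inter> {..<z}) \<le> K"
    using assms(1) card_mono[of "{..<K}" "C \<inter> {..<z}"] by auto
  ultimately have "K - card (C \<inter> {..<z}) < K - card (D \<inter> {..<z})" by linarith
  then show "\<exists>y\<in>{..K}. K - card (C \<inter> {..<y}) < K - card (D \<inter> {..<y})"
    by (intro bexI[of _ z]) (auto simp: z_def)
qed simp

text \<open>
  As long as two consecutive rows violate the order, exchange them.  The earlier of the two becomes
  strictly smaller and the rows before it stay, so the tableau decreases lexicographically; and the
  first row is either kept or replaced by a smaller one, hence stays in the order ideal.
\<close>

theorem straightening:
  fixes F :: "nat \<Rightarrow> nat \<Rightarrow> 'r::comm_ring_1"
  assumes \<Omega>: "order_ideal \<Omega>"
    and zero: "0 \<in> U" and add: "\<And>x y. x \<in> U \<Longrightarrow> y \<in> U \<Longrightarrow> x + y \<in> U"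
    and neg: "\<And>x. x \<in> U \<Longrightarrow> - x \<in> U"
    and std: "\<And>T. \<lbrakk>T \<in> tableaux m K N; standard T; hd T \<in> \<Omega>\<rbrakk> \<Longrightarrow> bracket_monomial F m T \<in> U"
    and T: "T \<in> tableaux m K N" "hd T \<in> \<Omega>"
  shows "bracket_monomial F m T \<in> U"
  using T
proof (induction T rule: wf_induct[OF wf_lex[OF wf_measure[of "height K"]]])
  case (1 T)
  have IH: "bracket_monomial F m T' \<in> U"
    if "(T', T) \<in> lex (measure (height K))" "T' \<in> tableaux m K N" "hd T' \<in> \<Omega>" for T'
    using 1(1) that by blast
  show ?case
  proof (cases "standard T")
    case False
    have tr: "transp precedes" by (auto intro: transpI precedes_trans)
    from False obtain i where i: "Suc i < length T" "\<not> precedes (T ! i) (T ! Suc i)"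
      unfolding standard_def sorted_wrt_iff_nth_Suc_transp[OF tr] by auto
    define pre post where "pre = take i T" and "post = drop (Suc (Suc i)) T"
    define A B where "A = T ! i" and "B = T ! Suc i"
    have Teq: "T = pre @ A # B # post"
      using i(1) by (simp add: pre_def post_def A_def B_def Cons_nth_drop_Suc id_take_nth_drop)
    have AB: "A \<subseteq> {..<K}" "card A = m" "B \<subseteq> {..<K}" "card B = m"
      using 1(2) by (auto simp: tableaux_def Teq)
    have fin: "finite A" "finite B" using AB finite_subset by blast+
    \<comment> \<open>The exchange relation is applied inside the product, with the other rows as fixed factors.\<close>
    let ?U = "{h. bracket_monomial F m pre * h * bracket_monomial F m post \<in> U}"
    have "ldet F [0..<m] A * ldet F [0..<m] B \<in> ?U"
    proof (rule bracket_exchange[OF fin(1) AB(2) fin(2) AB(4)])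
      show "\<not> precedes A B" using i(2) by (simp add: A_def B_def)
    next
      fix A' B'
      assume *: "A' \<subseteq> A \<union> B" "B' \<subseteq> A \<union> B" "card A' = m" "card B' = m" "precedes A' A" "\<not> precedes A A'"
      let ?T' = "pre @ A' # B' # post"
      have "height K A' < height K A"
        by (rule height_strict) (use * AB in auto)
      then have "(?T', T) \<in> lex (measure (height K))"
        unfolding Teq lex_conv by auto
      moreover have "?T' \<in> tableaux m K N"
        using 1(2) * AB by (auto simp: tableaux_def Teq)
      moreover have "hd ?T' \<in> \<Omega>"
        using 1(3) *(5) \<Omega> by (cases pre) (auto simp: Teq order_ideal_def)
      ultimately have "bracket_monomial F m ?T' \<in> U" by (rule IH)
      then show "ldet F [0..<m] A' * ldet F [0..<m] B' \<in> ?U"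
        by (simp add: bracket_monomial_def mult_ac)
    qed (use zero in \<open>auto simp: algebra_simps dest: add neg\<close>)
    then show ?thesis by (simp add: Teq bracket_monomial_def mult_ac)
  qed (use 1 std in auto)
qed

section \<open>Leading terms of standard products\<close>

text \<open>
  The exponent of the diagonal term of the minor with rows \<open>i, i + 1, \<dots>\<close> and columns \<open>C\<close> when
  the matrix has entries \<open>u ^ e i j\<close>: the element \<open>c\<close> of \<open>C\<close> stands in row
  \<open>i + card (C \<inter> {..<c})\<close>.
\<close>

definition diagonal_weight :: "(nat \<Rightarrow> nat \<Rightarrow> nat) \<Rightarrow> nat \<Rightarrow> nat set \<Rightarrow> nat" where
  "diagonal_weight e i C = (\<Sum>c\<in>C. e (i + card (C \<inter> {..<c})) c)"

lemma diagonal_weight_remove_Min: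
  assumes "finite C" "c \<in> C" "C \<inter> {..<c} = {}"
  shows "diagonal_weight e i C = e i c + diagonal_weight e (Suc i) (C - {c})"
proof -
  have "e (i + card (C \<inter> {..<d})) d = e (Suc i + card ((C - {c}) \<inter> {..<d})) d" if "d \<in> C - {c}" for d
  proof -
    have "c < d" using that assms by (metis Diff_iff Int_iff empty_iff insertCI lessThan_iff linorder_neqE_nat)
    then have "C \<inter> {..<d} = insert c ((C - {c}) \<inter> {..<d})" using assms by auto
    then have "card (C \<inter> {..<d}) = Suc (card ((C - {c}) \<inter> {..<d}))" using assms by simp
    then show ?thesis by simp
  qed
  then show ?thesis
    using assms by (simp add: diagonal_weight_def sum.remove)
qed

lemma monic_mult:
  fixes p q :: "'k::field poly"
  assumes "degree p = a \<and> lead_coeff p = 1" "degree q = b \<and> lead_coeff q = 1"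
  shows "degree (p * q) = a + b \<and> lead_coeff (p * q) = 1"
proof -
  have p: "degree p = a" "lead_coeff p = 1" and q: "degree q = b" "lead_coeff q = 1"
    using assms by blast+
  then have "p \<noteq> 0" "q \<noteq> 0" by auto
  then have "degree (p * q) = a + b" using p q by (simp add: degree_mult_eq)
  moreover have "lead_coeff (p * q) = 1" using p q lead_coeff_mult[of p q] by simp
  ultimately show ?thesis by blast
qed

lemma monic_add_lower:
  fixes p q :: "'k::field poly"
  assumes "degree p = a \<and> lead_coeff p = 1" "degree q < a"
  shows "degree (p + q) = a \<and> lead_coeff (p + q) = 1"
proof -
  have "degree (p + q) = a" using assms by (simp add: degree_add_eq_left)
  moreover have "coeff (p + q) a = 1" using assms by (auto simp: coeff_eq_0)
  ultimately show ?thesis by simp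
qed

text \<open>
  The hypothesis on \<open>e\<close> says that an entry dominates all entries in later rows and all entries further
  right in its own row, by a factor \<open>B\<close> that exceeds the size of the determinant.  Then in
  the expansion along the first row the smallest column beats every other one, whatever the
  remaining factors are.
\<close>

lemma ldet_diagonal_leading_term:
  fixes e :: "nat \<Rightarrow> nat \<Rightarrow> nat"
  defines "Y \<equiv> \<lambda>i j. monom (1 :: 'k::field) (e i j)"
  assumes dom: "\<And>i j i' j'. \<lbrakk>i' < m; j' < K; i < i' \<or> i = i' \<and> j < j'\<rbrakk> \<Longrightarrow> B * e i' j' \<le> e i j"
    and pos: "\<And>i j. e i j > 0" and B: "m < B"
  shows "\<lbrakk>C \<subseteq> {..<K}; i + card C = m\<rbrakk> \<Longrightarrow>
    degree (ldet Y [i..<m] C) = diagonal_weight e i C \<and> lead_coeff (ldet Y [i..<m] C) = 1"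
proof (induction "card C" arbitrary: i C)
  case 0
  then have "C = {}" using finite_subset by fastforce
  then show ?case using 0 by (simp add: diagonal_weight_def)
next
  case (Suc s)
  have fin: "finite C" using Suc.prems finite_subset by blast
  have im: "i < m" using Suc by linarith
  define c where "c = Min C"
  have "C \<noteq> {}" using Suc.hyps(2) by auto
  then have "c \<in> C" "\<forall>x\<in>C. c \<le> x" using fin by (auto simp: c_def)
  then have c: "c \<in> C" "C \<inter> {..<c} = {}" by (auto simp: not_less[symmetric])
  let ?w = "diagonal_weight e i C"
  let ?t = "\<lambda>j. (-1) ^ card (C \<inter> {..<j}) * Y i j * ldet Y [Suc i..<m] (C - {j})"
  have rec: "ldet Y [i..<m] C = (\<Sum>j\<in>C. ?t j)"
    using im by (simp add: upt_conv_Cons)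
  have IH: "degree (ldet Y [Suc i..<m] (C - {j})) = diagonal_weight e (Suc i) (C - {j}) \<and>
    lead_coeff (ldet Y [Suc i..<m] (C - {j})) = 1" if "j \<in> C" for j
  proof (rule Suc.hyps(1))
    have "Suc (card (C - {j})) = card C" using fin that by (rule card_Suc_Diff1)
    then show "s = card (C - {j})" "Suc i + card (C - {j}) = m"
      using Suc.hyps(2) Suc.prems by linarith+
  qed (use Suc.prems in auto)
  have w: "?w = e i c + diagonal_weight e (Suc i) (C - {c})"
    using diagonal_weight_remove_Min[OF fin c] .
  have tc: "?t c = monom 1 (e i c) * ldet Y [Suc i..<m] (C - {c})"
    using c by (simp add: Y_def)
  have dc: "degree (?t c) = ?w \<and> lead_coeff (?t c) = 1"
    unfolding tc w by (rule monic_mult[OF _ IH[OF c(1)]]) (simp add: degree_monom_eq)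
  have dj: "degree (?t j) < ?w" if j: "j \<in> C - {c}" for j
  proof -
    have cj: "c < j" using j c by (metis Diff_iff Int_iff empty_iff insertCI lessThan_iff linorder_neqE_nat)
    have "degree (?t j) \<le> degree ((-1) ^ card (C \<inter> {..<j}) * Y i j) + degree (ldet Y [Suc i..<m] (C - {j}))"
      by (rule degree_mult_le)
    also have "degree ((-1) ^ card (C \<inter> {..<j}) * Y i j) = e i j"
      by (cases "even (card (C \<inter> {..<j}))") (simp_all add: Y_def degree_monom_eq)
    finally have le: "degree (?t j) \<le> e i j + diagonal_weight e (Suc i) (C - {j})"
      using IH[of j] j by simp
    have e1: "B * e i j \<le> e i c" using dom[of i j i c] im cj j Suc.prems by auto
    have cell: "B * e (Suc i + card ((C - {j}) \<inter> {..<d})) d \<le> e i c" if d: "d \<in> C - {j}" for d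
    proof (rule dom)
      have "(C - {j}) \<inter> {..<d} \<subset> C - {j}" using d by auto
      then have "card ((C - {j}) \<inter> {..<d}) < card (C - {j})" using fin by (intro psubset_card_mono) auto
      then show "Suc i + card ((C - {j}) \<inter> {..<d}) < m"
        using Suc j fin by simp
    qed (use d Suc.prems in auto)
    have "B * (e i j + diagonal_weight e (Suc i) (C - {j}))
        = B * e i j + (\<Sum>d\<in>C - {j}. B * e (Suc i + card ((C - {j}) \<inter> {..<d})) d)"
      by (simp add: diagonal_weight_def sum_distrib_left distrib_left)
    also have "\<dots> \<le> e i c + (\<Sum>d\<in>C - {j}. e i c)"
      using e1 cell by (intro add_mono sum_mono)
    also have "\<dots> = Suc (card (C - {j})) * e i c"
      by simp
    also have "\<dots> = card C * e i c"
      using j fin card_Suc_Diff1[of C j] by simp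
    also have "\<dots> \<le> m * e i c" using Suc.prems by (intro mult_right_mono) auto
    also have "\<dots> < B * e i c" using B pos by simp
    finally have "e i j + diagonal_weight e (Suc i) (C - {j}) < e i c" by simp
    then show ?thesis using le w by linarith
  qed
  have split: "ldet Y [i..<m] C = ?t c + (\<Sum>j\<in>C - {c}. ?t j)"
    using rec fin c by (simp add: sum.remove)
  have wpos: "?w > 0" using w pos[of i c] by simp
  have "degree (\<Sum>j\<in>C - {c}. ?t j) < ?w"
  proof -
    have "degree (\<Sum>j\<in>C - {c}. ?t j) \<le> ?w - 1"
    proof (rule degree_sum_le)
      show "degree (?t j) \<le> ?w - 1" if "j \<in> C - {c}" for j using dj[OF that] by linarith
    qed (use fin in simp)
    then show ?thesis using wpos by linarith
  qed
  then show ?case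
    unfolding split by (rule monic_add_lower[OF dc])
qed

lemma bracket_monomial_leading_term:
  fixes e :: "nat \<Rightarrow> nat \<Rightarrow> nat"
  defines "Y \<equiv> \<lambda>i j. monom (1 :: 'k::field) (e i j)"
  assumes "\<And>i j i' j'. \<lbrakk>i' < m; j' < K; i < i' \<or> i = i' \<and> j < j'\<rbrakk> \<Longrightarrow> B * e i' j' \<le> e i j"
    and "\<And>i j. e i j > 0" and "m < B"
    and "\<forall>C\<in>set T. C \<subseteq> {..<K} \<and> card C = m"
  shows "degree (bracket_monomial Y m T) = (\<Sum>C\<leftarrow>T. diagonal_weight e 0 C) \<and>
    lead_coeff (bracket_monomial Y m T) = 1"
  using assms(5)
proof (induction T)
  case Nil
  then show ?case by (simp add: bracket_monomial_def)
next
  case (Cons C T)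
  have C: "degree (ldet Y [0..<m] C) = diagonal_weight e 0 C \<and> lead_coeff (ldet Y [0..<m] C) = 1"
    unfolding Y_def by (rule ldet_diagonal_leading_term[OF assms(2-4)]) (use Cons.prems in auto)
  have T: "\<forall>C\<in>set T. C \<subseteq> {..<K} \<and> card C = m" using Cons.prems by simp
  have eq: "bracket_monomial Y m (C # T) = ldet Y [0..<m] C * bracket_monomial Y m T"
    by (simp add: bracket_monomial_def)
  show ?case
    unfolding eq list.map sum_list.Cons by (rule monic_mult[OF C Cons.IH[OF T]])
qed

lemma digits_unique_lessThan:
  fixes f g :: "nat \<Rightarrow> nat"
  assumes "(\<Sum>k<n. f k * B ^ k) = (\<Sum>k<n. g k * B ^ k)" "\<And>k. k < n \<Longrightarrow> f k < B" "\<And>k. k < n \<Longrightarrow> g k < B"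
  shows "\<forall>k<n. f k = g k"
  using assms
proof (induction n arbitrary: f g)
  case (Suc n)
  have shift: "(\<Sum>k<Suc n. h k * B ^ k) = h 0 + B * (\<Sum>k<n. h (Suc k) * B ^ k)" for h :: "nat \<Rightarrow> nat"
    unfolding sum.lessThan_Suc_shift by (simp add: sum_distrib_left mult_ac)
  have eq: "f 0 + B * (\<Sum>k<n. f (Suc k) * B ^ k) = g 0 + B * (\<Sum>k<n. g (Suc k) * B ^ k)"
    using Suc.prems(1) unfolding shift .
  have B: "f 0 < B" "g 0 < B" using Suc.prems by auto
  have "f 0 = (f 0 + B * (\<Sum>k<n. f (Suc k) * B ^ k)) mod B" using B by simp
  also have "\<dots> = g 0" unfolding eq using B by simp
  finally have 0: "f 0 = g 0" .
  with eq B have "(\<Sum>k<n. f (Suc k) * B ^ k) = (\<Sum>k<n. g (Suc k) * B ^ k)" by simp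
  from Suc.IH[OF this] Suc.prems have "\<forall>k<n. f (Suc k) = g (Suc k)" by auto
  then show ?case using 0 less_Suc_eq_0_disj by auto
qed simp

lemma digits_unique:
  fixes f g :: "'a \<Rightarrow> nat"
  assumes S: "finite S" and inj: "inj_on idx S"
    and eq: "(\<Sum>s\<in>S. f s * B ^ idx s) = (\<Sum>s\<in>S. g s * B ^ idx s)"
    and f: "\<And>s. s \<in> S \<Longrightarrow> f s < B" and g: "\<And>s. s \<in> S \<Longrightarrow> g s < B"
    and s: "s \<in> S"
  shows "f s = g s"
proof -
  obtain n where n: "idx ` S \<subseteq> {..<n}" using S by (meson finite_imageI finite_nat_iff_bounded)
  define d where "d h k = (if k \<in> idx ` S then h (inv_into S idx k) else 0)" for h :: "'a \<Rightarrow> nat" and k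
  have d: "(\<Sum>k<n. d h k * B ^ k) = (\<Sum>s\<in>S. h s * B ^ idx s)" for h
  proof -
    have "(\<Sum>k<n. d h k * B ^ k) = (\<Sum>k\<in>idx ` S. d h k * B ^ k)"
      using n by (intro sum.mono_neutral_right) (auto simp: d_def)
    also have "\<dots> = (\<Sum>s\<in>S. h s * B ^ idx s)"
      using inj by (subst sum.reindex) (auto simp: d_def intro!: sum.cong)
    finally show ?thesis .
  qed
  have B: "0 < B" using f s by fastforce
  have "\<forall>k<n. d f k = d g k"
    by (rule digits_unique_lessThan) (use d eq B f g inv_into_into[of _ idx S] in \<open>auto simp: d_def\<close>)
  then have "d f (idx s) = d g (idx s)" using n s by auto
  then show ?thesis using s inj by (simp add: d_def)
qed

text \<open>
  The number of rows of the tableau \<open>T\<close> whose \<open>i\<close>-th smallest element (counting from 0) is \<open>j\<close>.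
\<close>

definition cell_count :: "nat set list \<Rightarrow> nat \<Rightarrow> nat \<Rightarrow> nat" where
  "cell_count T i j = length (filter (\<lambda>C. j \<in> C \<and> card (C \<inter> {..<j}) = i) T)"

lemma sum_diagonal_weight_eq_cell_count:
  assumes "\<forall>C\<in>set T. C \<subseteq> {..<K} \<and> card C = m"
  shows "(\<Sum>C\<leftarrow>T. diagonal_weight e 0 C) = (\<Sum>(i, j)\<in>{..<m} \<times> {..<K}. cell_count T i j * e i j)"
  using assms
proof (induction T)
  case Nil
  then show ?case by (simp add: cell_count_def)
next
  case (Cons C T)
  have C: "C \<subseteq> {..<K}" "card C = m" using Cons.prems by auto
  have fin: "finite C" using C finite_subset by blast
  have row: "card (C \<inter> {..<c}) < m" if "c \<in> C" for c
  proof -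
    have "C \<inter> {..<c} \<subset> C" using that by auto
    then show ?thesis using fin C(2) psubset_card_mono by blast
  qed
  have "diagonal_weight e 0 C = (\<Sum>j\<in>C. e (card (C \<inter> {..<j})) j)"
    by (simp add: diagonal_weight_def)
  also have "\<dots> = (\<Sum>j\<in>C. \<Sum>i<m. if card (C \<inter> {..<j}) = i then e i j else 0)"
    using row by (intro sum.cong) (auto simp: sum.delta)
  also have "\<dots> = (\<Sum>j<K. \<Sum>i<m. if j \<in> C \<and> card (C \<inter> {..<j}) = i then e i j else 0)"
    using C by (intro sum.mono_neutral_cong_left) (auto intro!: sum.cong)
  also have "\<dots> = (\<Sum>i<m. \<Sum>j<K. if j \<in> C \<and> card (C \<inter> {..<j}) = i then e i j else 0)"
    by (rule sum.swap)
  also have "\<dots> = (\<Sum>(i, j)\<in>{..<m} \<times> {..<K}. if j \<in> C \<and> card (C \<inter> {..<j}) = i then e i j else 0)"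
    by (rule sum.cartesian_product)
  finally have "(\<Sum>C\<leftarrow>C # T. diagonal_weight e 0 C) =
      (\<Sum>(i, j)\<in>{..<m} \<times> {..<K}. (if j \<in> C \<and> card (C \<inter> {..<j}) = i then e i j else 0) + cell_count T i j * e i j)"
    using Cons by (simp add: sum.distrib split_def)
  also have "\<dots> = (\<Sum>(i, j)\<in>{..<m} \<times> {..<K}. cell_count (C # T) i j * e i j)"
    by (intro sum.cong) (auto simp: cell_count_def)
  finally show ?case .
qed

lemma card_lessThan_Suc:
  fixes C :: "nat set"
  assumes "finite C"
  shows "card (C \<inter> {..<Suc y}) = card (C \<inter> {..<y}) + (if y \<in> C then 1 else 0)"
proof (cases "y \<in> C")
  case True
  then have "C \<inter> {..<Suc y} = insert y (C \<inter> {..<y})" by (auto simp: less_Suc_eq)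
  moreover have "finite (C \<inter> {..<y})" "y \<notin> C \<inter> {..<y}" by auto
  ultimately show ?thesis using True by simp
next
  case False
  then have "C \<inter> {..<Suc y} = C \<inter> {..<y}" by (auto simp: less_Suc_eq)
  then show ?thesis using False by simp
qed

text \<open>
  Both sides express that the \<open>i\<close>-th smallest element of \<open>C\<close> exists and is below \<open>y\<close>; at most one
  summand on the right is nonzero.
\<close>

lemma row_entry_less_iff_sum:
  fixes C :: "nat set"
  assumes "finite C"
  shows "(if i < card (C \<inter> {..<y}) then 1 else 0) = (\<Sum>j<y. if j \<in> C \<and> card (C \<inter> {..<j}) = i then 1 else 0 :: nat)"
proof (induction y)
  case (Suc y)
  show ?case
    unfolding sum.lessThan_Suc Suc[symmetric] card_lessThan_Suc[OF assms] by auto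
qed simp

lemma cell_count_sum:
  assumes "\<forall>C\<in>set T. finite C"
  shows "length (filter (\<lambda>C. i < card (C \<inter> {..<y})) T) = (\<Sum>j<y. cell_count T i j)"
  using assms
proof (induction T)
  case (Cons C T)
  have "length (filter (\<lambda>C. i < card (C \<inter> {..<y})) (C # T)) =
      (if i < card (C \<inter> {..<y}) then 1 else 0) + (\<Sum>j<y. cell_count T i j)"
    using Cons by simp
  also have "\<dots> = (\<Sum>j<y. (if j \<in> C \<and> card (C \<inter> {..<j}) = i then 1 else 0) + cell_count T i j)"
    using row_entry_less_iff_sum[of C i y] Cons.prems by (simp add: sum.distrib)
  also have "\<dots> = (\<Sum>j<y. cell_count (C # T) i j)"
    by (intro sum.cong) (auto simp: cell_count_def)
  finally show ?case .
qed (simp add: cell_count_def)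

lemma nth_iff_less_length_filter:
  "sorted_wrt (\<lambda>x y. P y \<longrightarrow> P x) xs \<Longrightarrow> k < length xs \<Longrightarrow> P (xs ! k) \<longleftrightarrow> k < length (filter P xs)"
proof (induction xs arbitrary: k)
  case (Cons x xs)
  show ?case
  proof (cases "P x")
    case True
    then show ?thesis using Cons by (cases k) auto
  next
    case False
    then have "filter P (x # xs) = []" using Cons.prems by (auto simp: filter_empty_conv)
    moreover have "\<not> P ((x # xs) ! k)" using False Cons.prems by (cases k) auto
    ultimately show ?thesis by simp
  qed
qed simp

lemma set_eq_if_initial_cards_eq:
  fixes C D :: "nat set"
  assumes "finite C" "finite D" "\<And>y. card (C \<inter> {..<y}) = card (D \<inter> {..<y})"
  shows "C = D"
proof -
  have "y \<in> C \<longleftrightarrow> y \<in> D" for y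
    using card_lessThan_Suc[OF assms(1), of y] card_lessThan_Suc[OF assms(2), of y]
      assms(3)[of y] assms(3)[of "Suc y"] by (simp split: if_splits del: lessThan_Suc)
  then show ?thesis by blast
qed

text \<open>
  In a standard tableau the \<open>i\<close>-th entries increase weakly from row to row, so the multiset of \<open>i\<close>-th entries,
  which \<open>cell_count\<close> records, determines them.
\<close>

lemma standard_tableau_eqI:
  assumes T: "T \<in> tableaux m K N" "standard T" and T': "T' \<in> tableaux m K N" "standard T'"
    and eq: "\<And>i j. \<lbrakk>i < m; j < K\<rbrakk> \<Longrightarrow> cell_count T i j = cell_count T' i j"
  shows "T = T'"
proof (rule nth_equalityI)
  show "length T = length T'" using T T' by (simp add: tableaux_def)
next
  fix k assume k: "k < length T"
  then have k': "k < length T'" using T T' by (simp add: tableaux_def)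
  have mem: "T ! k \<subseteq> {..<K}" "card (T ! k) = m" "T' ! k \<subseteq> {..<K}" "card (T' ! k) = m"
    using T T' k k' nth_mem[OF k] nth_mem[OF k'] by (auto simp: tableaux_def)
  have fin: "finite (T ! k)" "finite (T' ! k)" using mem finite_subset by blast+
  have filt: "i < card (S ! k \<inter> {..<y}) \<longleftrightarrow> k < (\<Sum>j<y. cell_count S i j)"
    if "S \<in> tableaux m K N" "standard S" "k < length S" for S i y
  proof -
    have "sorted_wrt (\<lambda>x z. i < card (z \<inter> {..<y}) \<longrightarrow> i < card (x \<inter> {..<y})) S"
      using that(2) unfolding standard_def
      by (rule sorted_wrt_mono_rel[rotated]) (auto simp: precedes_def intro: less_le_trans)
    then have "i < card (S ! k \<inter> {..<y}) \<longleftrightarrow> k < length (filter (\<lambda>C. i < card (C \<inter> {..<y})) S)"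
      using nth_iff_less_length_filter[of "\<lambda>C. i < card (C \<inter> {..<y})" S k] that(3) by simp
    moreover have "\<forall>C\<in>set S. finite C"
      using that(1) by (auto simp: tableaux_def intro: finite_subset)
    ultimately show ?thesis by (simp add: cell_count_sum)
  qed
  have iff: "i < card (T ! k \<inter> {..<y}) \<longleftrightarrow> i < card (T' ! k \<inter> {..<y})" if "y \<le> K" for i y
  proof (cases "i < m")
    case True
    then have "(\<Sum>j<y. cell_count T i j) = (\<Sum>j<y. cell_count T' i j)"
      using that eq by (intro sum.cong) auto
    then show ?thesis using filt[OF T k] filt[OF T' k'] by simp
  next
    case False
    have "card (T ! k \<inter> {..<y}) \<le> m" "card (T' ! k \<inter> {..<y}) \<le> m"
      using card_mono[OF fin(1), of "T ! k \<inter> {..<y}"] card_mono[OF fin(2), of "T' ! k \<inter> {..<y}"] mem by auto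
    then show ?thesis using False by linarith
  qed
  have eqK: "card (T ! k \<inter> {..<y}) = card (T' ! k \<inter> {..<y})" if "y \<le> K" for y
    using iff[OF that, of "card (T ! k \<inter> {..<y})"] iff[OF that, of "card (T' ! k \<inter> {..<y})"]
    by linarith
  show "T ! k = T' ! k"
  proof (rule set_eq_if_initial_cards_eq[OF fin])
    fix y
    have "T ! k \<inter> {..<y} = T ! k \<inter> {..<min y K}" "T' ! k \<inter> {..<y} = T' ! k \<inter> {..<min y K}"
      using mem by auto
    then show "card (T ! k \<inter> {..<y}) = card (T' ! k \<inter> {..<y})" using eqK[of "min y K"] by simp
  qed
qed

section \<open>Linear independence of standard products\<close>

definition eval_monomial :: "(nat \<times> nat \<Rightarrow> 'r::comm_ring_1) \<Rightarrow> monomial \<Rightarrow> 'r" where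
  "eval_monomial x u = (\<Prod>v\<in>Poly_Mapping.keys u. x v ^ Poly_Mapping.lookup u v)"

definition eval_polynomial ::
    "('k::field \<Rightarrow> 'r::comm_ring_1) \<Rightarrow> (nat \<times> nat \<Rightarrow> 'r) \<Rightarrow> 'k polynomial \<Rightarrow> 'r" where
  "eval_polynomial \<phi> x f = (\<Sum>u\<in>Poly_Mapping.keys f. \<phi> (Poly_Mapping.lookup f u) * eval_monomial x u)"

lemma eval_monomial_superset:
  "finite S \<Longrightarrow> Poly_Mapping.keys u \<subseteq> S \<Longrightarrow> eval_monomial x u = (\<Prod>v\<in>S. x v ^ Poly_Mapping.lookup u v)"
  unfolding eval_monomial_def by (rule prod.mono_neutral_left) (auto simp: in_keys_iff)

lemma eval_monomial_add: "eval_monomial x (u + w) = eval_monomial x u * eval_monomial x w"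
proof -
  let ?S = "Poly_Mapping.keys u \<union> Poly_Mapping.keys w"
  have "Poly_Mapping.keys (u + w) \<subseteq> ?S" by (rule Poly_Mapping.keys_add)
  then show ?thesis
    by (simp add: eval_monomial_superset[of ?S] lookup_add power_add prod.distrib)
qed

context
  fixes \<phi> :: "'k::field \<Rightarrow> 'r::comm_ring_1"
  assumes \<phi>_zero: "\<phi> 0 = 0" and \<phi>_one: "\<phi> 1 = 1"
    and \<phi>_add: "\<And>a b. \<phi> (a + b) = \<phi> a + \<phi> b" and \<phi>_mult: "\<And>a b. \<phi> (a * b) = \<phi> a * \<phi> b"
begin

lemma eval_polynomial_superset:
  "finite S \<Longrightarrow> Poly_Mapping.keys f \<subseteq> S \<Longrightarrow>
    eval_polynomial \<phi> x f = (\<Sum>u\<in>S. \<phi> (Poly_Mapping.lookup f u) * eval_monomial x u)"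
  unfolding eval_polynomial_def by (rule sum.mono_neutral_left) (auto simp: in_keys_iff \<phi>_zero)

lemma eval_polynomial_zero: "eval_polynomial \<phi> x 0 = 0"
  by (simp add: eval_polynomial_def)

lemma eval_polynomial_single: "eval_polynomial \<phi> x (Poly_Mapping.single u a) = \<phi> a * eval_monomial x u"
  by (simp add: eval_polynomial_superset[of "{u}"])

lemma eval_polynomial_one: "eval_polynomial \<phi> x 1 = 1"
  using eval_polynomial_single[of x 0 1] by (simp add: \<phi>_one eval_monomial_def)

lemma eval_polynomial_var: "eval_polynomial \<phi> x (var i j) = x (i, j)"
  unfolding var_def eval_polynomial_single by (simp add: \<phi>_one eval_monomial_def)

lemma eval_polynomial_add: "eval_polynomial \<phi> x (f + g) = eval_polynomial \<phi> x f + eval_polynomial \<phi> x g"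
proof -
  let ?S = "Poly_Mapping.keys f \<union> Poly_Mapping.keys g"
  have "Poly_Mapping.keys (f + g) \<subseteq> ?S" by (rule Poly_Mapping.keys_add)
  then show ?thesis
    by (simp add: eval_polynomial_superset[of ?S] lookup_add \<phi>_add distrib_right sum.distrib)
qed

lemma eval_polynomial_sum: "eval_polynomial \<phi> x (sum g A) = (\<Sum>a\<in>A. eval_polynomial \<phi> x (g a))"
  by (induction A rule: infinite_finite_induct) (simp_all add: eval_polynomial_zero eval_polynomial_add)

lemma polynomial_sum_monomials:
  "(\<Sum>u\<in>Poly_Mapping.keys f. Poly_Mapping.single u (Poly_Mapping.lookup f u)) = (f :: 'k polynomial)"
  by (rule poly_mapping_eqI)
    (simp add: lookup_sum lookup_single when_def sum.delta in_keys_iff)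

lemma eval_polynomial_mult: "eval_polynomial \<phi> x (f * g) = eval_polynomial \<phi> x f * eval_polynomial \<phi> x g"
proof -
  let ?s = "\<lambda>h u. Poly_Mapping.single u (Poly_Mapping.lookup h u) :: 'k polynomial"
  have "f * g = (\<Sum>u\<in>Poly_Mapping.keys f. \<Sum>w\<in>Poly_Mapping.keys g. ?s f u * ?s g w)"
    by (simp only: sum_product[symmetric] polynomial_sum_monomials)
  then have "eval_polynomial \<phi> x (f * g) =
      (\<Sum>u\<in>Poly_Mapping.keys f. \<Sum>w\<in>Poly_Mapping.keys g. eval_polynomial \<phi> x (?s f u * ?s g w))"
    by (simp only: eval_polynomial_sum)
  also have "\<dots> = (\<Sum>u\<in>Poly_Mapping.keys f. \<Sum>w\<in>Poly_Mapping.keys g.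
      (\<phi> (Poly_Mapping.lookup f u) * eval_monomial x u) * (\<phi> (Poly_Mapping.lookup g w) * eval_monomial x w))"
    by (simp add: mult_single eval_polynomial_single \<phi>_mult eval_monomial_add mult_ac)
  also have "\<dots> = eval_polynomial \<phi> x f * eval_polynomial \<phi> x g"
    by (simp only: eval_polynomial_def sum_product)
  finally show ?thesis .
qed

lemma eval_polynomial_ldet:
  "eval_polynomial \<phi> x (ldet F rs C) = ldet (\<lambda>i j. eval_polynomial \<phi> x (F i j)) rs C"
  by (rule ldet_hom) (simp_all add: eval_polynomial_zero eval_polynomial_one eval_polynomial_add eval_polynomial_mult)

lemma eval_polynomial_bracket_monomial:
  "eval_polynomial \<phi> x (bracket_monomial F m T) = bracket_monomial (\<lambda>i j. eval_polynomial \<phi> x (F i j)) m T"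
  by (induction T) (simp_all add: bracket_monomial_def eval_polynomial_one eval_polynomial_mult eval_polynomial_ldet)

end

text \<open>
  The entries of \<open>(X | 1)\<close>, with the identity matrix in the columns from \<open>n\<close> on.
\<close>

definition augmented :: "nat \<Rightarrow> nat \<Rightarrow> nat \<Rightarrow> 'k::field polynomial" where
  "augmented n i j = (if j < n then var i j else if j = n + i then 1 else 0)"

lemma bracket_monomial_cong:
  assumes "\<And>i C j. i < m \<Longrightarrow> C \<in> set T \<Longrightarrow> j \<in> C \<Longrightarrow> F i j = G i j"
  shows "bracket_monomial F m T = bracket_monomial G m T"
  unfolding bracket_monomial_def
  using assms by (intro arg_cong[of _ _ prod_list] map_cong refl ldet_cong) auto

lemma bracket_monomial_matrix_mult:
  assumes "\<forall>C\<in>set T. finite C \<and> card C = m"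
  shows "bracket_monomial (\<lambda>i j. \<Sum>l<m. G i l * H l j) m T =
    ldet G [0..<m] {..<m} ^ length T * bracket_monomial H m T"
  using assms
  by (induction T) (simp_all add: bracket_monomial_def ldet_matrix_mult mult_ac)

lemma distinct_degrees_independent:
  fixes p :: "'a \<Rightarrow> 'k::field poly"
  assumes "finite S" "(\<Sum>s\<in>S. smult (c s) (p s)) = 0"
    and nz: "\<And>s. s \<in> S \<Longrightarrow> p s \<noteq> 0" and inj: "inj_on (\<lambda>s. degree (p s)) S" and "s \<in> S"
  shows "c s = 0"
proof (rule ccontr)
  assume "c s \<noteq> 0"
  define S' where "S' = {s \<in> S. c s \<noteq> 0}"
  have S': "finite S'" "S' \<noteq> {}" using assms(1,5) \<open>c s \<noteq> 0\<close> by (auto simp: S'_def)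
  obtain a where a: "a \<in> S'" and max: "\<And>b. b \<in> S' \<Longrightarrow> degree (p b) \<le> degree (p a)"
  proof -
    let ?d = "(\<lambda>s. degree (p s)) ` S'"
    have "Max ?d \<in> ?d" using S' by (intro Max_in) auto
    then obtain a where "a \<in> S'" "degree (p a) = Max ?d" by auto
    moreover have "degree (p b) \<le> Max ?d" if "b \<in> S'" for b using S' that by (intro Max_ge) auto
    ultimately show ?thesis using that[of a] by simp
  qed
  have aS: "a \<in> S" "c a \<noteq> 0" using a by (auto simp: S'_def)
  have "coeff (\<Sum>s\<in>S. smult (c s) (p s)) (degree (p a)) = (\<Sum>s\<in>S. c s * coeff (p s) (degree (p a)))"
    by (simp add: coeff_sum)
  also have "\<dots> = (\<Sum>s\<in>{a}. c s * coeff (p s) (degree (p a)))"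
  proof (rule sum.mono_neutral_right)
    show "\<forall>b\<in>S - {a}. c b * coeff (p b) (degree (p a)) = 0"
    proof
      fix b assume b: "b \<in> S - {a}"
      show "c b * coeff (p b) (degree (p a)) = 0"
      proof (cases "c b = 0")
        case False
        then have "degree (p b) \<le> degree (p a)" using b by (intro max) (auto simp: S'_def)
        moreover have "degree (p b) \<noteq> degree (p a)" using inj b aS by (auto dest: inj_onD)
        ultimately show ?thesis by (simp add: coeff_eq_0)
      qed simp
    qed
  qed (use assms(1) aS in auto)
  also have "\<dots> \<noteq> 0" using aS nz by simp
  finally show False using assms(2) by simp
qed

lemma inverse_of_nonzero_det:
  fixes G :: "nat \<Rightarrow> nat \<Rightarrow> 'f::field"
  assumes "ldet G [0..<m] {..<m} \<noteq> 0"
  obtains G' where "\<And>i j. i < m \<Longrightarrow> j < m \<Longrightarrow> (\<Sum>l<m. G i l * G' l j) = (if i = j then 1 else 0)"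
    "\<And>i j. i < m \<Longrightarrow> j < m \<Longrightarrow> (\<Sum>l<m. G' i l * G l j) = (if i = j then 1 else 0)"
proof -
  let ?G = "mat m m (\<lambda>(i, l). G i l)"
  have "ldet G [0..<m] {..<m} = det (mat m m (\<lambda>(i, j). G i (sorted_list_of_set {..<m} ! j)))"
    by (rule ldet_upt_eq_det) auto
  also have "mat m m (\<lambda>(i, j). G i (sorted_list_of_set {..<m} ! j)) = ?G"
    by (rule eq_matI) (simp_all add: lessThan_atLeast0)
  finally have "det ?G \<noteq> 0" using assms by simp
  then have "?G \<in> Units (ring_mat TYPE('f) m ())"
    by (intro det_non_zero_imp_unit) auto
  then obtain B where B: "B \<in> carrier_mat m m" "B * ?G = 1\<^sub>m m" "?G * B = 1\<^sub>m m"
    unfolding Units_def by (auto simp: ring_mat_def)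
  have "(\<Sum>l<m. G i l * B $$ (l, j)) = (if i = j then 1 else 0)" if "i < m" "j < m" for i j
  proof -
    have "(?G * B) $$ (i, j) = (\<Sum>l<m. G i l * B $$ (l, j))"
      using that B(1) by (simp add: scalar_prod_def lessThan_atLeast0)
    then show ?thesis using B(3) that by simp
  qed
  moreover have "(\<Sum>l<m. B $$ (i, l) * G l j) = (if i = j then 1 else 0)" if "i < m" "j < m" for i j
  proof -
    have "(B * ?G) $$ (i, j) = (\<Sum>l<m. B $$ (i, l) * G l j)"
      using that B(1) by (simp add: scalar_prod_def lessThan_atLeast0)
    then show ?thesis using B(2) that by simp
  qed
  ultimately show ?thesis using that[of "\<lambda>l j. B $$ (l, j)"] by blast
qed

text \<open>
  If the last \<open>m\<close> columns of \<open>y\<close> form an invertible matrix \<open>G\<close>, then \<open>y = G (H | 1)\<close>, where \<open>H\<close> is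
  the inverse of \<open>G\<close> times the first columns.  So each bracket of \<open>y\<close> is \<open>det G\<close> times the bracket of
  \<open>(X | 1)\<close> evaluated at \<open>X = H\<close>.
\<close>

lemma dehomogenization:
  fixes y :: "nat \<Rightarrow> nat \<Rightarrow> 'f::field"
  assumes nz: "ldet y [0..<m] {n..<n + m} \<noteq> 0"
    and \<phi>: "\<phi> 0 = 0" "\<phi> (1 :: 'k::field) = 1" "\<And>a b. \<phi> (a + b) = \<phi> a + \<phi> b" "\<And>a b. \<phi> (a * b) = \<phi> a * \<phi> b"
  obtains x D where "\<And>T. \<forall>C\<in>set T. C \<subseteq> {..<n + m} \<and> card C = m \<Longrightarrow>
    bracket_monomial y m T = D ^ length T * eval_polynomial \<phi> x (bracket_monomial (augmented n) m T)"
proof -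
  define G where "G i l = y i (n + l)" for i l
  have "ldet G [0..<m] {..<m} = ldet y [0..<m] ((\<lambda>l. n + l) ` {..<m}) \<or>
      ldet G [0..<m] {..<m} = - ldet y [0..<m] ((\<lambda>l. n + l) ` {..<m})"
    unfolding G_def by (rule ldet_relabel(1)) auto
  moreover have "(\<lambda>l. n + l) ` {..<m} = {n..<n + m}"
    by (simp add: lessThan_atLeast0 add.commute)
  ultimately have "ldet G [0..<m] {..<m} \<noteq> 0" using nz by auto
  then obtain G' where GG': "\<And>i j. i < m \<Longrightarrow> j < m \<Longrightarrow> (\<Sum>l<m. G i l * G' l j) = (if i = j then 1 else 0)"
    and G'G: "\<And>i j. i < m \<Longrightarrow> j < m \<Longrightarrow> (\<Sum>l<m. G' i l * G l j) = (if i = j then 1 else 0)"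
    using inverse_of_nonzero_det by blast
  define H where "H l j = (\<Sum>i<m. G' l i * y i j)" for l j
  define x where "x = (\<lambda>(i, j). H i j)"
  have y: "y i j = (\<Sum>l<m. G i l * H l j)" if "i < m" for i j
  proof -
    have "(\<Sum>l<m. G i l * H l j) = (\<Sum>l<m. \<Sum>i'<m. G i l * G' l i' * y i' j)"
      by (simp add: H_def sum_distrib_left mult_ac)
    also have "\<dots> = (\<Sum>i'<m. (\<Sum>l<m. G i l * G' l i') * y i' j)"
      by (subst sum.swap) (simp add: sum_distrib_right)
    also have "\<dots> = (\<Sum>i'<m. if i' = i then y i' j else 0)"
      using that by (intro sum.cong) (auto simp: GG')
    also have "\<dots> = y i j" using that by simp
    finally show ?thesis by simp
  qed
  have H: "eval_polynomial \<phi> x (augmented n i j) = H i j" if "i < m" "j < n + m" for i j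
  proof (cases "j < n")
    case True
    then show ?thesis by (simp add: augmented_def eval_polynomial_var[OF \<phi>] x_def)
  next
    case False
    then have "H i j = (\<Sum>l<m. G' i l * G l (j - n))" by (simp add: H_def G_def)
    also have "\<dots> = (if i = j - n then 1 else 0)" using that False by (intro G'G) auto
    finally show ?thesis
      using False by (auto simp: augmented_def eval_polynomial_zero[OF \<phi>] eval_polynomial_one[OF \<phi>])
  qed
  have "bracket_monomial y m T = ldet G [0..<m] {..<m} ^ length T * eval_polynomial \<phi> x (bracket_monomial (augmented n) m T)"
    if T: "\<forall>C\<in>set T. C \<subseteq> {..<n + m} \<and> card C = m" for T
  proof -
    have "bracket_monomial y m T = bracket_monomial (\<lambda>i j. \<Sum>l<m. G i l * H l j) m T"
      by (rule bracket_monomial_cong) (use y in auto)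
    also have "\<dots> = ldet G [0..<m] {..<m} ^ length T * bracket_monomial H m T"
      by (rule bracket_monomial_matrix_mult) (use T finite_subset in blast)
    also have "bracket_monomial H m T = bracket_monomial (\<lambda>i j. eval_polynomial \<phi> x (augmented n i j)) m T"
      by (rule bracket_monomial_cong) (use H T in \<open>auto simp: subset_iff\<close>)
    also have "\<dots> = eval_polynomial \<phi> x (bracket_monomial (augmented n) m T)"
      by (rule eval_polynomial_bracket_monomial[OF \<phi>, symmetric])
    finally show ?thesis .
  qed
  then show ?thesis by (rule that)
qed

text \<open>
  The matrix \<open>y\<close> has entries \<open>u ^ e i j\<close> in the field of rational functions in one variable \<open>u\<close>, with
  exponents that are powers of \<open>B\<close>.  The degree of a product of brackets of \<open>y\<close> then has the numbers
  \<open>cell_count T i j\<close> as its digits in base \<open>B\<close>, so different standard tableaux give different degrees.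
\<close>

theorem standard_bracket_monomials_independent:
  fixes c :: "nat set list \<Rightarrow> 'k::field" and m n N :: nat
  defines "S \<equiv> {T \<in> tableaux m (n + m) N. standard T}"
  assumes rel: "(\<Sum>T\<in>S. Poly_Mapping.single 0 (c T) * bracket_monomial (augmented n) m T) = 0"
    and T: "T \<in> S"
  shows "c T = 0"
proof -
  define K where "K = n + m"
  define B where "B = Suc (m + N)"
  \<comment> \<open>Cells are numbered so that earlier rows, and within a row columns further left, get larger
     numbers; \<open>B\<close> exceeds \<open>m\<close>, as the leading term lemma needs, and \<open>N\<close>, which bounds the digits.\<close>
  define idx where "idx i j = K * (m - 1 - i) + (K - 1 - j)" for i j
  define e where "e i j = B ^ idx i j" for i j
  have dom: "B * e i' j' \<le> e i j" if "i' < m" "j' < K" "i < i' \<or> i = i' \<and> j < j'" for i j i' j'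
  proof -
    have "Suc (idx i' j') \<le> idx i j"
    proof (cases "i < i'")
      case True
      have "Suc (idx i' j') \<le> K * (m - 1 - i') + K" using that by (simp add: idx_def)
      also have "\<dots> = K * Suc (m - 1 - i')" by simp
      also have "\<dots> \<le> K * (m - 1 - i)" using True that by (intro mult_left_mono) auto
      finally show ?thesis by (simp add: idx_def)
    qed (use that in \<open>auto simp: idx_def\<close>)
    then have "B ^ Suc (idx i' j') \<le> B ^ idx i j" by (intro power_increasing) (auto simp: B_def)
    then show ?thesis by (simp add: e_def)
  qed
  have pos: "e i j > 0" for i j by (simp add: e_def B_def)
  have mB: "m < B" by (simp add: B_def)
  define Y where "Y = (\<lambda>i j. monom (1 :: 'k) (e i j))"
  have lead: "degree (bracket_monomial Y m T) = (\<Sum>C\<leftarrow>T. diagonal_weight e 0 C) \<and>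
      lead_coeff (bracket_monomial Y m T) = 1" if "\<forall>C\<in>set T. C \<subseteq> {..<K} \<and> card C = m" for T
    unfolding Y_def by (rule bracket_monomial_leading_term[OF dom pos mB that])
  have S: "finite S" unfolding S_def using finite_tableaux by simp
  have ST: "\<forall>C\<in>set T. C \<subseteq> {..<K} \<and> card C = m" "length T = N" "T \<in> tableaux m K N" "standard T"
    if "T \<in> S" for T using that by (auto simp: S_def tableaux_def K_def)
  let ?y = "\<lambda>i j. to_fract (Y i j)"
  let ?\<phi> = "\<lambda>a :: 'k. to_fract [:a:]"
  have \<phi>: "?\<phi> 0 = 0" "?\<phi> 1 = 1" "?\<phi> (a + b) = ?\<phi> a + ?\<phi> b" "?\<phi> (a * b) = ?\<phi> a * ?\<phi> b" for a b
    by (simp_all add: to_fract_add[symmetric] to_fract_mult[symmetric] one_pCons[symmetric]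
          del: to_fract_add to_fract_mult)
  have fract_ldet: "ldet ?y rs C = to_fract (ldet Y rs C)" for rs C
    by (rule ldet_hom[symmetric]) simp_all
  have fract: "bracket_monomial ?y m T = to_fract (bracket_monomial Y m T)" for T
    by (induction T) (simp_all add: bracket_monomial_def fract_ldet)
  \<comment> \<open>The last \<open>m\<close> columns are invertible, again by the leading term.\<close>
  have "{n..<n + m} \<subseteq> {..<n + m}" by auto
  then have "bracket_monomial Y m [{n..<n + m}] \<noteq> 0"
    using lead[of "[{n..<n + m}]"] by (auto simp: K_def)
  then have "ldet ?y [0..<m] {n..<n + m} \<noteq> 0"
    by (simp add: fract_ldet bracket_monomial_def)
  then obtain x D where xD: "\<And>T. \<forall>C\<in>set T. C \<subseteq> {..<n + m} \<and> card C = m \<Longrightarrow>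
      bracket_monomial ?y m T = D ^ length T * eval_polynomial ?\<phi> x (bracket_monomial (augmented n) m T)"
    using dehomogenization[of ?y m n ?\<phi>, OF _ \<phi>] by blast
  have "to_fract (\<Sum>T\<in>S. smult (c T) (bracket_monomial Y m T)) = (\<Sum>T\<in>S. ?\<phi> (c T) * bracket_monomial ?y m T)"
  proof -
    have "to_fract (\<Sum>T\<in>A. smult (c T) (bracket_monomial Y m T)) =
        (\<Sum>T\<in>A. ?\<phi> (c T) * bracket_monomial ?y m T)" if "finite A" for A
      using that by induction (simp_all add: fract to_fract_mult[symmetric] del: to_fract_mult)
    then show ?thesis using S .
  qed
  also have "\<dots> = (\<Sum>T\<in>S. D ^ N * (?\<phi> (c T) * eval_polynomial ?\<phi> x (bracket_monomial (augmented n) m T)))"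
    using ST xD by (intro sum.cong) (auto simp: K_def mult_ac)
  also have "\<dots> = D ^ N * eval_polynomial ?\<phi> x
      (\<Sum>T\<in>S. Poly_Mapping.single 0 (c T) * bracket_monomial (augmented n) m T)"
    by (simp add: eval_polynomial_sum[OF \<phi>] eval_polynomial_mult[OF \<phi>] eval_polynomial_single[OF \<phi>]
          eval_monomial_def sum_distrib_left)
  also have "\<dots> = 0" unfolding rel by (simp add: eval_polynomial_zero[OF \<phi>])
  finally have "(\<Sum>T\<in>S. smult (c T) (bracket_monomial Y m T)) = 0"
    by (simp only: to_fract_eq_0_iff)
  then show ?thesis
  proof (rule distinct_degrees_independent[OF S])
    show "bracket_monomial Y m T \<noteq> 0" if "T \<in> S" for T
      using lead[OF ST(1)[OF that]] by auto
    show "inj_on (\<lambda>T. degree (bracket_monomial Y m T)) S"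
    proof (rule inj_onI)
      fix T T' assume T: "T \<in> S" and T': "T' \<in> S"
        and "degree (bracket_monomial Y m T) = degree (bracket_monomial Y m T')"
      then have "(\<Sum>C\<leftarrow>T. diagonal_weight e 0 C) = (\<Sum>C\<leftarrow>T'. diagonal_weight e 0 C)"
        using lead[OF ST(1)] by metis
      then have eq: "(\<Sum>s\<in>{..<m} \<times> {..<K}. (\<lambda>(i, j). cell_count T i j) s * B ^ (\<lambda>(i, j). idx i j) s) =
          (\<Sum>s\<in>{..<m} \<times> {..<K}. (\<lambda>(i, j). cell_count T' i j) s * B ^ (\<lambda>(i, j). idx i j) s)"
        using sum_diagonal_weight_eq_cell_count[OF ST(1)[OF T], of e]
          sum_diagonal_weight_eq_cell_count[OF ST(1)[OF T'], of e]
        by (simp add: e_def split_def)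
      have le: "cell_count T i j < B" if "T \<in> S" for T i j
        using length_filter_le[of _ T] ST(2)[OF that] by (simp add: cell_count_def B_def less_Suc_eq_le trans_le_add2)
      have inj: "inj_on (\<lambda>(i, j). idx i j) ({..<m} \<times> {..<K})"
      proof (rule inj_onI, clarify)
        fix i j i' j' assume *: "i < m" "j < K" "i' < m" "j' < K" "idx i j = idx i' j'"
        have dm: "(K * q + r) div K = q" "(K * q + r) mod K = r" if "r < K" for q r
          using that by simp_all
        have "idx a b div K = m - 1 - a" "idx a b mod K = K - 1 - b" if "b < K" for a b
        proof -
          have r: "K - 1 - b < K" using that by simp
          show "idx a b div K = m - 1 - a" "idx a b mod K = K - 1 - b"
            unfolding idx_def by (rule dm[OF r])+
        qed
        with * have "m - 1 - i = m - 1 - i'" "K - 1 - j = K - 1 - j'" by metis+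
        with * show "i = i' \<and> j = j'" by auto
      qed
      show "T = T'"
      proof (rule standard_tableau_eqI[OF ST(3,4)[OF T] ST(3,4)[OF T']])
        fix i j assume "i < m" "j < K"
        then show "cell_count T i j = cell_count T' i j"
          using digits_unique[OF _ inj eq, of "(i, j)"] le[OF T] le[OF T'] by auto
      qed
    qed
  qed (rule T)
qed

section \<open>Minors of the generic matrix as brackets\<close>

lemma sorted_list_of_set_append:
  fixes C1 C2 :: "nat set"
  assumes "finite C1" "finite C2" "\<And>x y. x \<in> C1 \<Longrightarrow> y \<in> C2 \<Longrightarrow> x < y"
  shows "sorted_list_of_set (C1 \<union> C2) = sorted_list_of_set C1 @ sorted_list_of_set C2"
proof -
  let ?l = "sorted_list_of_set C1 @ sorted_list_of_set C2"
  have "sorted_wrt (<) ?l" using assms by (simp add: sorted_wrt_append)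
  moreover have "set ?l = C1 \<union> C2" using assms by simp
  ultimately show ?thesis
    by (metis sorted_list_of_set.idem_if_sorted_distinct strict_sorted_iff)
qed

text \<open>
  The transposed form of \<open>ldet_laplace\<close>.  Since all of \<open>C1\<close> comes before \<open>C2\<close>, the
  sorted column list is split into two segments.
\<close>

theorem ldet_laplace_columns:
  fixes F :: "nat \<Rightarrow> nat \<Rightarrow> 'r::comm_ring_1"
  assumes I: "finite I" "card I = card C1 + card C2" and C: "finite C1" "finite C2"
    and less: "\<And>x y. x \<in> C1 \<Longrightarrow> y \<in> C2 \<Longrightarrow> x < y"
  shows "ldet F (sorted_list_of_set I) (C1 \<union> C2) =
    (\<Sum>S | S \<subseteq> I \<and> card S = card C1. (-1) ^ inversions S (I - S) *
      ldet F (sorted_list_of_set S) C1 * ldet F (sorted_list_of_set (I - S)) C2)"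
proof -
  let ?F = "\<lambda>j i. F i j" and ?s = "sorted_list_of_set"
  have disj: "C1 \<inter> C2 = {}" using less by fastforce
  have "ldet F (?s I) (C1 \<union> C2) = ldet ?F (?s (C1 \<union> C2)) I"
    using I C disj by (intro ldet_transpose) (auto simp: card_Un_disjoint)
  also have "\<dots> = ldet ?F (?s C1 @ ?s C2) I"
    by (simp only: sorted_list_of_set_append[OF C less])
  also have "\<dots> = (\<Sum>S\<in>Pow I. (-1) ^ inversions S (I - S) * ldet ?F (?s C1) S * ldet ?F (?s C2) (I - S))"
    by (rule ldet_laplace[OF I(1)])
  also have "\<dots> = (\<Sum>S | S \<subseteq> I \<and> card S = card C1. (-1) ^ inversions S (I - S) *
      ldet F (?s S) C1 * ldet F (?s (I - S)) C2)"
  proof (rule sum.mono_neutral_cong_right)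
    show "\<forall>S\<in>Pow I - {S. S \<subseteq> I \<and> card S = card C1}.
        (-1) ^ inversions S (I - S) * ldet ?F (?s C1) S * ldet ?F (?s C2) (I - S) = 0"
    proof
      fix S assume "S \<in> Pow I - {S. S \<subseteq> I \<and> card S = card C1}"
      then have "card S \<noteq> length (?s C1)" by auto
      then have "ldet ?F (?s C1) S = 0" using ldet_nonzero_card by blast
      then show "(-1) ^ inversions S (I - S) * ldet ?F (?s C1) S * ldet ?F (?s C2) (I - S) = 0" by simp
    qed
  next
    fix S assume S: "S \<in> {S. S \<subseteq> I \<and> card S = card C1}"
    then have fS: "finite S" using I finite_subset by blast
    have cS: "card S = card C1" "card (I - S) = card C2"
      using S I fS by (auto simp: card_Diff_subset)
    have "ldet ?F (?s C1) S = ldet F (?s S) C1"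
      by (rule ldet_transpose[symmetric]) (use fS cS C in auto)
    moreover have "ldet ?F (?s C2) (I - S) = ldet F (?s (I - S)) C2"
      by (rule ldet_transpose[symmetric]) (use I cS C in auto)
    ultimately show "(-1) ^ inversions S (I - S) * ldet ?F (?s C1) S * ldet ?F (?s C2) (I - S) =
        (-1) ^ inversions S (I - S) * ldet F (?s S) C1 * ldet F (?s (I - S)) C2" by simp
  qed (use I in auto)
  finally show ?thesis .
qed

text \<open>
  \<open>C1\<close> consists of the \<open>t\<close> smallest elements of \<open>C\<close>; so \<open>C1\<close> contains as many elements below \<open>b\<close> as
  possible.
\<close>

lemma obtain_initial_columns:
  fixes C :: "nat set"
  assumes "finite C" "t \<le> card C"
  obtains C1 C2 where "C = C1 \<union> C2" "\<And>x y. x \<in> C1 \<Longrightarrow> y \<in> C2 \<Longrightarrow> x < y" "card C1 = t" "card C2 = card C - t"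
    "\<And>b. min t (card (C \<inter> {..<b})) \<le> card (C1 \<inter> {..<b})"
proof -
  let ?l = "sorted_list_of_set C"
  define C1 C2 where "C1 = set (take t ?l)" and "C2 = set (drop t ?l)"
  have l: "take t ?l @ drop t ?l = ?l" by simp
  have "sorted_wrt (<) (take t ?l @ drop t ?l)" unfolding l by simp
  then have less: "\<And>x y. x \<in> C1 \<Longrightarrow> y \<in> C2 \<Longrightarrow> x < y"
    by (auto simp: sorted_wrt_append C1_def C2_def simp del: append_take_drop_id)
  have "set (take t ?l) \<union> set (drop t ?l) = set ?l" by (metis l set_append)
  then have C: "C = C1 \<union> C2" using assms(1) by (simp add: C1_def C2_def)
  have c1: "card C1 = t" and c2: "card C2 = card C - t"
    using assms by (simp_all add: C1_def C2_def distinct_card)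
  have "min t (card (C \<inter> {..<b})) \<le> card (C1 \<inter> {..<b})" for b
  proof (cases "C1 \<subseteq> {..<b}")
    case True
    then have "C1 \<inter> {..<b} = C1" by auto
    then show ?thesis using c1 by simp
  next
    case False
    then obtain x where "x \<in> C1" "b \<le> x" by (auto simp: subset_iff not_less)
    then have "C2 \<inter> {..<b} = {}" using less by fastforce
    then have "C \<inter> {..<b} = C1 \<inter> {..<b}" using C by auto
    then show ?thesis by simp
  qed
  then show ?thesis using that C less c1 c2 by blast
qed

lemma ldet_identity:
  "sorted_wrt (<) rs \<Longrightarrow>
    ldet (\<lambda>r c. if c = r then 1 else 0 :: 'r::comm_ring_1) rs C = (if C = set rs then 1 else 0)"
proof (induction rs arbitrary: C)
  case (Cons r rs)
  let ?F = "\<lambda>r c. if c = r then 1 else 0 :: 'r"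
  have r: "r \<notin> set rs" "set rs \<inter> {..<r} = {}" using Cons.prems by fastforce+
  have IH: "ldet ?F rs (C - {r}) = (if C - {r} = set rs then 1 else 0)"
    using Cons by simp
  show ?case
  proof (cases "finite C \<and> r \<in> C")
    case True
    have "ldet ?F (r # rs) C = (\<Sum>j\<in>C. if j = r then (-1) ^ card (C \<inter> {..<r}) * ldet ?F rs (C - {r}) else 0)"
      by (auto intro: sum.cong)
    also have "\<dots> = (-1) ^ card (C \<inter> {..<r}) * ldet ?F rs (C - {r})"
      using True by simp
    also have "\<dots> = (if C = set (r # rs) then 1 else 0)"
    proof (cases "C - {r} = set rs")
      case eq: True
      then have "C = set (r # rs)" using True by auto
      moreover from this have "C \<inter> {..<r} = {}" using r by auto
      ultimately show ?thesis using IH eq by simp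
    next
      case False
      then have "C \<noteq> set (r # rs)" using r by auto
      then show ?thesis using IH False by simp
    qed
    finally show ?thesis .
  next
    case False
    then have "ldet ?F (r # rs) C = 0"
      by (cases "finite C") (auto intro!: sum.neutral)
    moreover have "C \<noteq> set (r # rs)" using False by auto
    ultimately show ?thesis by simp
  qed
qed simp

abbreviation minor :: "nat set \<Rightarrow> nat set \<Rightarrow> 'k::field polynomial" where
  "minor I J \<equiv> ldet var (sorted_list_of_set I) J"

lemma ldet_augmented_identity_columns:
  fixes A :: "nat \<Rightarrow> nat \<Rightarrow> 'k::field polynomial" and n :: nat
  defines "A \<equiv> augmented n"
  assumes "D \<subseteq> {..<m}" "E \<subseteq> {..<m}"
  shows "ldet A (sorted_list_of_set D) ((\<lambda>i. n + i) ` E) = (if D = E then 1 else 0) \<or>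
    ldet A (sorted_list_of_set D) ((\<lambda>i. n + i) ` E) = - (if D = E then 1 else 0)"
proof -
  have fin: "finite D" "finite E" using assms finite_subset by blast+
  let ?l = "sorted_list_of_set D"
  have "(\<lambda>r c. A r (n + c)) = (\<lambda>r c. if c = r then 1 else 0)"
    by (intro ext) (simp add: augmented_def A_def)
  then have eq: "ldet (\<lambda>r c. A r (n + c)) ?l E = (if E = D then 1 else 0)"
    using ldet_identity[of ?l E] fin by simp
  have rel: "ldet (\<lambda>r c. A r (n + c)) ?l E = ldet A ?l ((\<lambda>i. n + i) ` E) \<or>
      ldet (\<lambda>r c. A r (n + c)) ?l E = - ldet A ?l ((\<lambda>i. n + i) ` E)"
    by (rule ldet_relabel(1)[OF fin(2)]) simp
  have neg: "y = - 1" if "- y = 1" for y :: "'k polynomial"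
    using that by (metis minus_minus)
  show ?thesis using rel unfolding eq by (cases "E = D") (auto dest: neg)
qed

lemma augmented_minor:
  "J \<subseteq> {..<n} \<Longrightarrow> ldet (augmented n) rs J = ldet var rs J"
  by (rule ldet_cong) (auto simp: augmented_def)

text \<open>
  Complete the columns \<open>J\<close> by the identity columns of the rows outside \<open>I\<close>.  In the Laplace
  expansion along \<open>J\<close>, the complementary factor is a minor of the identity matrix, and it vanishes
  unless the chosen rows are those in \<open>I\<close>.
\<close>

lemma minor_eq_bracket:
  fixes A :: "nat \<Rightarrow> nat \<Rightarrow> 'k::field polynomial" and n :: nat
  defines "A \<equiv> augmented n"
  assumes I: "I \<subseteq> {..<m}" and J: "J \<subseteq> {..<n}" and card: "card I = card J"
  defines "C \<equiv> J \<union> (\<lambda>i. n + i) ` ({..<m} - I)"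
  shows "minor I J = ldet A [0..<m] C \<or> minor I J = - ldet A [0..<m] C"
    and "C \<subseteq> {..<n + m}" "card C = m" "\<And>b. b \<le> n \<Longrightarrow> C \<inter> {..<b} = J \<inter> {..<b}"
proof -
  let ?E = "(\<lambda>i. n + i) ` ({..<m} - I)"
  have fin: "finite I" "finite J" using I J finite_subset by blast+
  have less: "x < y" if "x \<in> J" "y \<in> ?E" for x y using that J by fastforce
  have cE: "card ?E = m - card I"
    using I fin by (subst card_image) (auto simp: card_Diff_subset)
  have Im: "card I \<le> m" using I card_mono[of "{..<m}" I] by simp
  have "J \<inter> ?E = {}" using less by fastforce
  then show "card C = m" using fin cE card Im by (simp add: C_def card_Un_disjoint)
  show "C \<subseteq> {..<n + m}" using J by (auto simp: C_def)
  show "\<And>b. b \<le> n \<Longrightarrow> C \<inter> {..<b} = J \<inter> {..<b}" by (auto simp: C_def)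
  let ?A = "augmented n :: nat \<Rightarrow> nat \<Rightarrow> 'k polynomial" and ?s = "sorted_list_of_set"
  have "ldet ?A (?s {..<m}) C = (\<Sum>S | S \<subseteq> {..<m} \<and> card S = card J. (-1) ^ inversions S ({..<m} - S) *
      ldet ?A (?s S) J * ldet ?A (?s ({..<m} - S)) ?E)"
    unfolding C_def by (rule ldet_laplace_columns) (use fin less cE card Im in auto)
  also have "\<dots> = (\<Sum>S\<in>{I}. (-1) ^ inversions S ({..<m} - S) *
      ldet ?A (?s S) J * ldet ?A (?s ({..<m} - S)) ?E)"
  proof (rule sum.mono_neutral_right)
    show "\<forall>S\<in>{S. S \<subseteq> {..<m} \<and> card S = card J} - {I}.
        (-1) ^ inversions S ({..<m} - S) * ldet ?A (?s S) J * ldet ?A (?s ({..<m} - S)) ?E = 0"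
    proof
      fix S assume "S \<in> {S. S \<subseteq> {..<m} \<and> card S = card J} - {I}"
      then have "{..<m} - S \<noteq> {..<m} - I" using I by auto
      then have "ldet ?A (?s ({..<m} - S)) ?E = 0"
        using ldet_augmented_identity_columns[of "{..<m} - S" m "{..<m} - I" n] by auto
      then show "(-1) ^ inversions S ({..<m} - S) * ldet ?A (?s S) J * ldet ?A (?s ({..<m} - S)) ?E = 0"
        by simp
    qed
  qed (use I card in auto)
  finally have eq: "ldet ?A [0..<m] C = (-1) ^ inversions I ({..<m} - I) * minor I J *
      ldet ?A (?s ({..<m} - I)) ?E"
    by (simp add: augmented_minor[OF J] lessThan_atLeast0)
  have "ldet ?A (?s ({..<m} - I)) ?E = 1 \<or> ldet ?A (?s ({..<m} - I)) ?E = - 1"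
    using ldet_augmented_identity_columns[of "{..<m} - I" m "{..<m} - I" n] by auto
  then show "minor I J = ldet A [0..<m] C \<or> minor I J = - ldet A [0..<m] C"
    unfolding A_def eq by (cases "even (inversions I ({..<m} - I))") auto
qed

section \<open>Ideals spanned by tableaux\<close>

global_interpretation kspace: vector_space "\<lambda>c (f :: 'k::field polynomial). Poly_Mapping.single 0 c * f"
  by unfold_locales (simp_all add: distrib_left distrib_right single_add mult_single mult.assoc[symmetric])

definition tableau_span :: "nat \<Rightarrow> nat \<Rightarrow> nat \<Rightarrow> nat set set \<Rightarrow> 'k::field polynomial set" where
  "tableau_span m n N \<Omega> = kspace.span (bracket_monomial (augmented n) m ` {T \<in> tableaux m (n + m) N. hd T \<in> \<Omega>})"

lemma tableau_span_standard:
  fixes f :: "'k::field polynomial"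
  assumes \<Omega>: "order_ideal \<Omega>" and f: "f \<in> tableau_span m n N \<Omega>"
  shows "f \<in> kspace.span (bracket_monomial (augmented n) m ` {T \<in> tableaux m (n + m) N. standard T \<and> hd T \<in> \<Omega>})"
proof -
  let ?U = "kspace.span (bracket_monomial (augmented n) m ` {T \<in> tableaux m (n + m) N. standard T \<and> hd T \<in> \<Omega>}) :: 'k polynomial set"
  have "bracket_monomial (augmented n) m T \<in> ?U" if T: "T \<in> tableaux m (n + m) N" "hd T \<in> \<Omega>" for T
  proof (rule straightening[OF \<Omega> _ _ _ _ T])
    show "bracket_monomial (augmented n) m T' \<in> ?U"
      if "T' \<in> tableaux m (n + m) N" "standard T'" "hd T' \<in> \<Omega>" for T'
      using that by (intro kspace.span_base) auto
  qed (simp_all add: kspace.span_zero kspace.span_add kspace.span_neg)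
  then have "tableau_span m n N \<Omega> \<subseteq> ?U"
    unfolding tableau_span_def by (intro kspace.span_minimal) auto
  then show ?thesis using f by blast
qed

lemma standard_bracket_monomials_basis:
  fixes m n N :: nat
  defines "S \<equiv> {T \<in> tableaux m (n + m) N. standard T}"
    and "b \<equiv> bracket_monomial (augmented n :: nat \<Rightarrow> nat \<Rightarrow> 'k::field polynomial) m"
  shows "inj_on b S" "\<not> kspace.dependent (b ` S)"
proof -
  have fS: "finite S" using finite_tableaux by (simp add: S_def)
  have ind: "c T = 0" if "(\<Sum>T\<in>S. Poly_Mapping.single 0 (c T) * b T) = 0" "T \<in> S" for c :: "nat set list \<Rightarrow> 'k" and T
    using standard_bracket_monomials_independent[where c = c and m = m and n = n and N = N and T = T] that by (simp add: S_def b_def)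
  show inj: "inj_on b S"
  proof (rule inj_onI, rule ccontr)
    fix T T' assume *: "T \<in> S" "T' \<in> S" "b T = b T'" "T \<noteq> T'"
    \<comment> \<open>Two equal products would give the relation with coefficients \<open>1\<close> and \<open>- 1\<close>.\<close>
    define c :: "nat set list \<Rightarrow> 'k" where "c = (\<lambda>U. if U = T then 1 else if U = T' then - 1 else 0)"
    have "(\<Sum>U\<in>S. Poly_Mapping.single 0 (c U) * b U) =
        (\<Sum>U\<in>S. (if U = T then b U else 0) + (if U = T' then - b U else 0))"
      using *(4) by (intro sum.cong) (auto simp: c_def single_uminus)
    also have "\<dots> = b T - b T'"
      using * fS by (simp add: sum.distrib)
    finally have "c T = 0" using * by (intro ind) auto
    then show False by (simp add: c_def)
  qed
  show "\<not> kspace.dependent (b ` S)"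
  proof (rule kspace.independent_if_scalars_zero)
    fix g x assume g: "(\<Sum>x\<in>b ` S. Poly_Mapping.single 0 (g x) * x) = 0" and "x \<in> b ` S"
    then obtain T where T: "T \<in> S" "x = b T" by auto
    have "(\<Sum>T\<in>S. Poly_Mapping.single 0 (g (b T)) * b T) = 0"
      using g by (simp add: sum.reindex[OF inj])
    from ind[OF this T(1)] show "g x = 0" by (simp add: T)
  qed (use fS in simp)
qed

text \<open>
  By straightening, standard products suffice.  Those with first row in \<open>\<Omega>1\<close> and those with first row
  in \<open>\<Omega>2\<close> are subsets of one linearly independent set, so an element of both spans involves only
  products that belong to both subsets.
\<close>

theorem tableau_span_Int:
  assumes "order_ideal \<Omega>1" "order_ideal \<Omega>2"
    and f: "f \<in> tableau_span m n N \<Omega>1" "f \<in> tableau_span m n N \<Omega>2"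
  shows "(f :: 'k::field polynomial) \<in> tableau_span m n N (\<Omega>1 \<inter> \<Omega>2)"
proof -
  let ?b = "bracket_monomial (augmented n :: nat \<Rightarrow> nat \<Rightarrow> 'k polynomial) m"
  define S where "S \<Omega> = {T \<in> tableaux m (n + m) N. standard T \<and> hd T \<in> \<Omega>}" for \<Omega>
  let ?B = "?b ` S UNIV"
  have SU: "S UNIV = {T \<in> tableaux m (n + m) N. standard T}" by (simp add: S_def)
  have inj: "inj_on ?b (S UNIV)" and ind: "\<not> kspace.dependent ?B"
    unfolding SU by (rule standard_bracket_monomials_basis)+
  have fB: "finite ?B" unfolding SU using finite_tableaux by simp
  have supp: "b \<in> ?b ` S \<Omega>" if "order_ideal \<Omega>" "f \<in> tableau_span m n N \<Omega>"
    "kspace.representation ?B f b \<noteq> 0" for \<Omega> b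
  proof -
    have "f \<in> kspace.span (?b ` S \<Omega>)"
      using tableau_span_standard[OF that(1,2)] by (simp add: S_def)
    moreover have "?b ` S \<Omega> \<subseteq> ?B" by (auto simp: S_def)
    ultimately have "kspace.representation ?B f = kspace.representation (?b ` S \<Omega>) f"
      by (rule kspace.representation_extend[OF ind])
    then show ?thesis using that(3) kspace.representation_ne_zero by metis
  qed
  have fspan: "f \<in> kspace.span ?B"
  proof -
    have "?b ` S \<Omega>1 \<subseteq> ?B" by (auto simp: S_def)
    then have "kspace.span (?b ` S \<Omega>1) \<subseteq> kspace.span ?B" by (rule kspace.span_mono)
    moreover have "f \<in> kspace.span (?b ` S \<Omega>1)"
      using tableau_span_standard[OF assms(1) f(1)] by (simp add: S_def)
    ultimately show ?thesis by blast
  qed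
  have "(\<Sum>b\<in>?B. Poly_Mapping.single 0 (kspace.representation ?B f b) * b) \<in> tableau_span m n N (\<Omega>1 \<inter> \<Omega>2)"
    unfolding tableau_span_def
  proof (rule kspace.span_sum)
    fix b assume b: "b \<in> ?B"
    show "Poly_Mapping.single 0 (kspace.representation ?B f b) * b
        \<in> kspace.span (?b ` {T \<in> tableaux m (n + m) N. hd T \<in> \<Omega>1 \<inter> \<Omega>2})"
    proof (cases "kspace.representation ?B f b = 0")
      case True
      then show ?thesis by (simp add: kspace.span_zero)
    next
      case False
      obtain T1 where T1: "T1 \<in> S \<Omega>1" "b = ?b T1" using supp[OF assms(1) f(1) False] by auto
      obtain T2 where T2: "T2 \<in> S \<Omega>2" "b = ?b T2" using supp[OF assms(2) f(2) False] by auto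
      have "T1 = T2" using T1 T2 inj_onD[OF inj, of T1 T2] by (auto simp: S_def)
      then have "b \<in> ?b ` {T \<in> tableaux m (n + m) N. hd T \<in> \<Omega>1 \<inter> \<Omega>2}"
        using T1 T2 by (auto simp: S_def)
      then show ?thesis by (intro kspace.span_scale kspace.span_base)
    qed
  qed
  then show ?thesis
    using kspace.sum_representation_eq[OF ind fspan fB] by simp
qed

lemma poly_ring_const: "Poly_Mapping.single 0 c \<in> carrier (poly_ring m n)"
  by (simp add: poly_ring_carrier)

lemma poly_ring_sum: "(\<And>i. i \<in> A \<Longrightarrow> f i \<in> carrier (poly_ring m n)) \<Longrightarrow> sum f A \<in> carrier (poly_ring m n)"
  by (induction A rule: infinite_finite_induct) (auto simp: poly_ring_zero poly_ring_add)

lemma poly_ring_sign: "(-1) ^ k \<in> carrier (poly_ring m n :: 'k::field polynomial ring)"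
  by (cases "even k") (auto simp: poly_ring_one poly_ring_uminus)

lemma ldet_carrier:
  "(\<And>r c. r \<in> set rs \<Longrightarrow> c \<in> C \<Longrightarrow> F r c \<in> carrier (poly_ring m n)) \<Longrightarrow>
    ldet F rs C \<in> carrier (poly_ring m n)"
proof (induction rs arbitrary: C)
  case Nil
  then show ?case by (simp add: poly_ring_zero poly_ring_one)
next
  case (Cons r rs)
  have "ldet F rs (C - {j}) \<in> carrier (poly_ring m n)" for j
    by (rule Cons.IH) (use Cons.prems in auto)
  then show ?case using Cons.prems
    by (auto intro!: poly_ring_sum poly_ring_mult poly_ring_sign)
qed

lemma augmented_carrier: "i < m \<Longrightarrow> augmented n i j \<in> carrier (poly_ring m n)"
  by (simp add: augmented_def var_in_carrier poly_ring_zero poly_ring_one)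

lemma bracket_monomial_carrier: "bracket_monomial (augmented n) m T \<in> carrier (poly_ring m n)"
proof (induction T)
  case Nil
  then show ?case by (simp add: bracket_monomial_def poly_ring_one)
next
  case (Cons C T)
  then show ?case
    by (auto simp: bracket_monomial_def intro!: poly_ring_mult ldet_carrier augmented_carrier)
qed

lemma minor_carrier:
  assumes "I \<subseteq> {..<m}" "J \<subseteq> {..<n}"
  shows "minor I J \<in> carrier (poly_ring m n)"
proof -
  have "finite I" using assms(1) finite_subset by blast
  then show ?thesis
    using assms by (intro ldet_carrier var_in_carrier) (auto simp: subset_iff)
qed

lemma poly_ring_induct [consumes 1, case_names const var add]:
  fixes f :: "'k::field polynomial"
  assumes f: "f \<in> carrier (poly_ring m n)"
    and const: "\<And>c. P (Poly_Mapping.single 0 c)"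
    and var: "\<And>i j f. i < m \<Longrightarrow> j < n \<Longrightarrow> P f \<Longrightarrow> P (var i j * f)"
    and add: "\<And>f g. P f \<Longrightarrow> P g \<Longrightarrow> P (f + g)"
  shows "P f"
proof -
  let ?S = "{..<m} \<times> {..<n}"
  have monomial_case: "P (Poly_Mapping.single u c)" if "Poly_Mapping.keys u \<subseteq> ?S" for u c
    using that
  proof (induction "\<Sum>v\<in>?S. Poly_Mapping.lookup u v" arbitrary: u)
    case 0
    have "Poly_Mapping.lookup u v = 0" for v
    proof (cases "v \<in> ?S")
      case True
      then show ?thesis using 0(1) by (cases v) auto
    next
      case False
      then have "v \<notin> Poly_Mapping.keys u" using 0(2) by blast
      then show ?thesis by (simp add: in_keys_iff)
    qed
    then have "u = 0" by (intro poly_mapping_eqI) simp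
    then show ?case using const by simp
  next
    case (Suc k)
    from Suc.hyps(2) have "\<exists>v\<in>?S. Poly_Mapping.lookup u v \<noteq> 0"
      by (metis (no_types, lifting) nat.distinct(1) sum.neutral)
    then obtain i j where ij: "i < m" "j < n" "Poly_Mapping.lookup u (i, j) > 0" by auto
    define u' where "u' = u - Poly_Mapping.single (i, j) 1"
    have u: "u = Poly_Mapping.single (i, j) 1 + u'"
      by (rule poly_mapping_eqI) (use ij in \<open>auto simp: u'_def lookup_add lookup_minus lookup_single when_def\<close>)
    have "Poly_Mapping.keys u' \<subseteq> Poly_Mapping.keys u"
    proof
      fix v assume "v \<in> Poly_Mapping.keys u'"
      then have "Poly_Mapping.lookup u' v \<noteq> 0" by (simp add: in_keys_iff)
      then have "Poly_Mapping.lookup u v \<noteq> 0" by (simp add: u'_def lookup_minus)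
      then show "v \<in> Poly_Mapping.keys u" by (simp add: in_keys_iff)
    qed
    then have "Poly_Mapping.keys u' \<subseteq> ?S" using Suc.prems by blast
    moreover have "(\<Sum>v\<in>?S. Poly_Mapping.lookup u v) = (\<Sum>v\<in>?S. (if v = (i, j) then 1 else 0) + Poly_Mapping.lookup u' v)"
      unfolding u by (intro sum.cong) (auto simp: lookup_add lookup_single when_def)
    then have "k = (\<Sum>v\<in>?S. Poly_Mapping.lookup u' v)"
      using Suc.hyps(2) ij by (simp add: sum.distrib)
    ultimately have "P (Poly_Mapping.single u' c)" using Suc.hyps(1) by blast
    then have "P (var i j * Poly_Mapping.single u' c)" using var ij by blast
    then show ?case by (simp add: u var_def mult_single)
  qed
  have "P (\<Sum>u\<in>A. Poly_Mapping.single u (Poly_Mapping.lookup f u))" if "finite A" "A \<subseteq> Poly_Mapping.keys f" for A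
    using that
  proof (induction A)
    case empty
    then show ?case using const[of 0] by simp
  next
    case (insert u A)
    have "Poly_Mapping.keys u \<subseteq> ?S" using f insert.prems by (auto simp: poly_ring_carrier)
    then show ?case using insert monomial_case add by simp
  qed
  then have "P (\<Sum>u\<in>Poly_Mapping.keys f. Poly_Mapping.single u (Poly_Mapping.lookup f u))" by simp
  then show ?thesis by (simp only: polynomial_sum_monomials)
qed

lemma poly_ring_idealI:
  fixes U :: "'k::field polynomial set"
  assumes "U \<subseteq> carrier (poly_ring m n)" "0 \<in> U"
    and add: "\<And>f g. f \<in> U \<Longrightarrow> g \<in> U \<Longrightarrow> f + g \<in> U"
    and mult: "\<And>f g. f \<in> carrier (poly_ring m n) \<Longrightarrow> g \<in> U \<Longrightarrow> f * g \<in> U"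
  shows "ideal U (poly_ring m n)"
proof -
  let ?R = "poly_ring m n :: 'k polynomial ring"
  interpret cring ?R by (rule cring_poly_ring)
  have minus: "\<ominus>\<^bsub>?R\<^esub> f = - f" if "f \<in> carrier ?R" for f
    using that by (intro minus_equality) (simp_all add: poly_ring_uminus)
  show ?thesis
  proof (rule idealI)
    show "ring ?R" by (rule ring_axioms)
    show "subgroup U (add_monoid ?R)"
    proof (rule subgroup.intro)
      fix f assume f: "f \<in> U"
      have "(- 1) * f \<in> U" using f by (intro mult) (auto simp: poly_ring_one poly_ring_uminus)
      moreover have "inv\<^bsub>add_monoid ?R\<^esub> f = - f"
        using minus[of f] f assms(1) by (auto simp: a_inv_def)
      ultimately show "inv\<^bsub>add_monoid ?R\<^esub> f \<in> U" by simp
    qed (use assms add in auto)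
    show "f \<otimes>\<^bsub>?R\<^esub> g \<in> U" if "g \<in> U" "f \<in> carrier ?R" for f g using mult that by simp
    show "g \<otimes>\<^bsub>?R\<^esub> f \<in> U" if "g \<in> U" "f \<in> carrier ?R" for f g using mult[of f g] that by (simp add: mult.commute)
  qed
qed

lemma poly_ring_ideal_closed:
  fixes U :: "'k::field polynomial set"
  assumes "ideal U (poly_ring m n)"
  shows "0 \<in> U" "\<And>f g. f \<in> U \<Longrightarrow> g \<in> U \<Longrightarrow> f + g \<in> U"
    "\<And>f g. f \<in> carrier (poly_ring m n) \<Longrightarrow> g \<in> U \<Longrightarrow> f * g \<in> U"
    "\<And>A (h :: 'i \<Rightarrow> _). (\<And>i. i \<in> A \<Longrightarrow> h i \<in> U) \<Longrightarrow> sum h A \<in> U"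
proof -
  interpret ideal U "poly_ring m n" by fact
  show 0: "0 \<in> U" using additive_subgroup.zero_closed[OF is_additive_subgroup] by simp
  show add: "\<And>f g. f \<in> U \<Longrightarrow> g \<in> U \<Longrightarrow> f + g \<in> U"
    using additive_subgroup.a_closed[OF is_additive_subgroup] by simp
  show "\<And>f g. f \<in> carrier (poly_ring m n) \<Longrightarrow> g \<in> U \<Longrightarrow> f * g \<in> U"
    using I_l_closed by simp
  show "sum h A \<in> U" if "\<And>i. i \<in> A \<Longrightarrow> h i \<in> U" for A and h :: "'i \<Rightarrow> _"
    using that by (induction A rule: infinite_finite_induct) (auto intro: 0 add)
qed

lemma tableau_span_carrier: "tableau_span m n N \<Omega> \<subseteq> carrier (poly_ring m n)"
proof -
  have "kspace.subspace (carrier (poly_ring m n))"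
    by (rule kspace.subspaceI) (auto intro: poly_ring_zero poly_ring_add poly_ring_mult poly_ring_const)
  then show ?thesis
    unfolding tableau_span_def by (intro kspace.span_minimal) (auto intro: bracket_monomial_carrier)
qed

lemma tableau_span_times_bracket:
  fixes f :: "'k::field polynomial"
  assumes f: "f \<in> tableau_span m n N \<Omega>" and "0 < N" and C: "C \<subseteq> {..<n + m}" "card C = m"
  shows "ldet (augmented n) [0..<m] C * f \<in> tableau_span m n (Suc N) \<Omega>"
proof -
  let ?b = "bracket_monomial (augmented n :: nat \<Rightarrow> nat \<Rightarrow> 'k polynomial) m"
  let ?U = "{f. ldet (augmented n) [0..<m] C * f \<in> tableau_span m n (Suc N) \<Omega>}"
  have sub: "kspace.subspace ?U"
    unfolding tableau_span_def
    by (rule kspace.subspaceI)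
      (auto simp: kspace.span_zero kspace.span_add distrib_left mult.left_commute[of _ "Poly_Mapping.single 0 _"] kspace.span_scale)
  have "?b ` {T \<in> tableaux m (n + m) N. hd T \<in> \<Omega>} \<subseteq> ?U"
  proof clarify
    fix T assume T: "T \<in> tableaux m (n + m) N" "hd T \<in> \<Omega>"
    have "T @ [C] \<in> tableaux m (n + m) (Suc N)" using T C by (auto simp: tableaux_def)
    moreover have "hd (T @ [C]) \<in> \<Omega>" using T \<open>0 < N\<close> by (auto simp: tableaux_def hd_append)
    ultimately have "?b (T @ [C]) \<in> tableau_span m n (Suc N) \<Omega>"
      unfolding tableau_span_def by (intro kspace.span_base) blast
    moreover have "?b (T @ [C]) = ldet (augmented n) [0..<m] C * ?b T"
      by (simp add: bracket_monomial_def mult.commute)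
    ultimately show "ldet (augmented n) [0..<m] C * ?b T \<in> tableau_span m n (Suc N) \<Omega>" by simp
  qed
  from kspace.span_minimal[OF this sub] show ?thesis
    using f unfolding tableau_span_def[of m n N] by blast
qed

lemma tableau_span_times_minor:
  fixes f :: "'k::field polynomial"
  assumes f: "f \<in> tableau_span m n N \<Omega>" and "0 < N"
    and I: "I \<subseteq> {..<m}" and J: "J \<subseteq> {..<n}" and card: "card I = card J"
  shows "minor I J * f \<in> tableau_span m n (Suc N) \<Omega>"
proof -
  let ?C = "J \<union> (\<lambda>i. n + i) ` ({..<m} - I)"
  have "ldet (augmented n) [0..<m] ?C * f \<in> tableau_span m n (Suc N) \<Omega>"
    by (rule tableau_span_times_bracket[OF f \<open>0 < N\<close> minor_eq_bracket(2,3)[OF I J card]])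
  moreover from this have "- (ldet (augmented n) [0..<m] ?C * f) \<in> tableau_span m n (Suc N) \<Omega>"
    unfolding tableau_span_def by (rule kspace.span_neg)
  ultimately show ?thesis
    using minor_eq_bracket(1)[OF I J card, where 'k = 'k] by auto
qed

text \<open>
  The empty minor is 1, and up to sign it is the bracket of the identity columns; appending that row
  changes the length but not the value.
\<close>

lemma tableau_span_lengthen:
  fixes f :: "'k::field polynomial"
  assumes "f \<in> tableau_span m n N \<Omega>" "0 < N" "N \<le> N'"
  shows "f \<in> tableau_span m n N' \<Omega>"
  using assms(3)
proof (induction N' rule: dec_induct)
  case (step M)
  then show ?case
    using tableau_span_times_minor[OF step.IH, of "{}" "{}"] assms(2) by simp
qed (rule assms(1))

text \<open>
  The length \<open>N\<close> is at least 1, so that a first row exists.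
\<close>

definition tableau_ideal :: "nat \<Rightarrow> nat \<Rightarrow> nat set set \<Rightarrow> 'k::field polynomial set" where
  "tableau_ideal m n \<Omega> = (\<Union>N\<in>{1..}. tableau_span m n N \<Omega>)"

text \<open>
  A variable is a \<open>1\<close>-minor, hence up to sign a bracket, and multiplying by it appends a row at the
  end, where it does not affect the first row.
\<close>

lemma ideal_tableau_ideal: "ideal (tableau_ideal m n \<Omega> :: 'k::field polynomial set) (poly_ring m n)"
proof (rule poly_ring_idealI)
  let ?U = "tableau_ideal m n \<Omega> :: 'k polynomial set"
  show "?U \<subseteq> carrier (poly_ring m n)"
    by (auto simp: tableau_ideal_def dest: subsetD[OF tableau_span_carrier])
  show "0 \<in> ?U"
    by (auto simp: tableau_ideal_def tableau_span_def kspace.span_zero)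
  show add: "f + g \<in> ?U" if fg: "f \<in> ?U" "g \<in> ?U" for f g
  proof -
    obtain N N' where N: "1 \<le> N" "f \<in> tableau_span m n N \<Omega>" and N': "1 \<le> N'" "g \<in> tableau_span m n N' \<Omega>"
      using fg by (auto simp: tableau_ideal_def)
    have "f \<in> tableau_span m n (max N N') \<Omega>" "g \<in> tableau_span m n (max N N') \<Omega>"
      using tableau_span_lengthen[OF N(2)] tableau_span_lengthen[OF N'(2)] N N' by auto
    then have "f + g \<in> tableau_span m n (max N N') \<Omega>"
      unfolding tableau_span_def by (rule kspace.span_add)
    moreover have "max N N' \<in> {1..}" using N by auto
    ultimately show ?thesis unfolding tableau_ideal_def by blast
  qed
  show "f * g \<in> ?U" if f: "f \<in> carrier (poly_ring m n)" and g: "g \<in> ?U" for f g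
    using f
  proof (induction f rule: poly_ring_induct)
    case (const c)
    then show ?case using g by (auto simp: tableau_ideal_def tableau_span_def intro: kspace.span_scale)
  next
    case (var i j h)
    then obtain N where N: "1 \<le> N" "h * g \<in> tableau_span m n N \<Omega>" by (auto simp: tableau_ideal_def)
    have "(minor {i} {j} :: 'k polynomial) * (h * g) \<in> tableau_span m n (Suc N) \<Omega>"
      by (rule tableau_span_times_minor) (use N var in auto)
    moreover have "(minor {i} {j} :: 'k polynomial) = var i j" by simp
    ultimately show ?case by (auto simp: tableau_ideal_def mult.assoc)
  next
    case (add f1 f2)
    then show ?case using \<open>\<And>f g. f \<in> ?U \<Longrightarrow> g \<in> ?U \<Longrightarrow> f + g \<in> ?U\<close> by (simp add: distrib_right)
  qed
qed

lemma minor_in_tableau_ideal: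
  fixes I J :: "nat set"
  assumes I: "I \<subseteq> {..<m}" and J: "J \<subseteq> {..<n}" and card: "card I = card J"
    and \<Omega>: "J \<union> (\<lambda>i. n + i) ` ({..<m} - I) \<in> \<Omega>"
  shows "(minor I J :: 'k::field polynomial) \<in> tableau_ideal m n \<Omega>"
proof -
  let ?A = "augmented n :: nat \<Rightarrow> nat \<Rightarrow> 'k polynomial"
  let ?C = "J \<union> (\<lambda>i. n + i) ` ({..<m} - I)"
  have "[?C] \<in> tableaux m (n + m) 1"
    using minor_eq_bracket(2,3)[OF I J card] by (simp add: tableaux_def)
  then have "bracket_monomial ?A m [?C] \<in> tableau_span m n 1 \<Omega>"
    unfolding tableau_span_def using \<Omega> by (intro kspace.span_base) auto
  then have *: "ldet ?A [0..<m] ?C \<in> tableau_span m n 1 \<Omega>"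
    by (simp add: bracket_monomial_def)
  then have "- ldet ?A [0..<m] ?C \<in> tableau_span m n 1 \<Omega>"
    unfolding tableau_span_def by (rule kspace.span_neg)
  with * have "(minor I J :: 'k polynomial) \<in> tableau_span m n 1 \<Omega>"
    using minor_eq_bracket(1)[OF I J card, where 'k = 'k] by auto
  then show ?thesis by (auto simp: tableau_ideal_def)
qed

theorem tableau_ideal_Int:
  assumes "order_ideal \<Omega>1" "order_ideal \<Omega>2"
  shows "tableau_ideal m n \<Omega>1 \<inter> tableau_ideal m n \<Omega>2 \<subseteq> (tableau_ideal m n (\<Omega>1 \<inter> \<Omega>2) :: 'k::field polynomial set)"
proof
  fix f :: "'k polynomial" assume "f \<in> tableau_ideal m n \<Omega>1 \<inter> tableau_ideal m n \<Omega>2"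
  then obtain N N' where N: "1 \<le> N" "f \<in> tableau_span m n N \<Omega>1" and N': "1 \<le> N'" "f \<in> tableau_span m n N' \<Omega>2"
    by (auto simp: tableau_ideal_def)
  have "f \<in> tableau_span m n (max N N') \<Omega>1" "f \<in> tableau_span m n (max N N') \<Omega>2"
    using tableau_span_lengthen[OF N(2)] tableau_span_lengthen[OF N'(2)] N N' by auto
  then have "f \<in> tableau_span m n (max N N') (\<Omega>1 \<inter> \<Omega>2)"
    by (rule tableau_span_Int[OF assms])
  moreover have "max N N' \<in> {1..}" using N by auto
  ultimately show "f \<in> tableau_ideal m n (\<Omega>1 \<inter> \<Omega>2)"
    unfolding tableau_ideal_def by blast
qed

section \<open>Minors with prescribed columns and their degrees\<close>

lemma pick_eq_nth_sorted_list_of_set: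
  assumes "finite I" "k < card I"
  shows "pick I k = sorted_list_of_set I ! k"
proof -
  let ?i = "sorted_list_of_set I ! k"
  have "{a \<in> I. a < ?i} = I \<inter> {..<?i}" by auto
  then have "card {a \<in> I. a < ?i} = k" "?i \<in> I"
    using sorted_list_of_set_remove_nth(2,3)[OF assms] by simp_all
  then show ?thesis using pick_card_in_set[of ?i I] by simp
qed

lemma minors_generic_mat:
  "minors t (generic_mat m n :: 'k::field polynomial mat) =
    {minor I J | I J. I \<subseteq> {..<m} \<and> card I = t \<and> J \<subseteq> {..<n} \<and> card J = t}"
proof -
  have det: "det (submatrix (generic_mat m n) I J) = (minor I J :: 'k polynomial)"
    if I: "I \<subseteq> {..<m}" "card I = t" and J: "J \<subseteq> {..<n}" "card J = t" for I J
  proof -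
    have fin: "finite I" "finite J" using I J finite_subset by blast+
    have sets: "{i. i < m \<and> i \<in> I} = I" "{j. j < n \<and> j \<in> J} = J" using I J by auto
    have "submatrix (generic_mat m n :: 'k polynomial mat) I J =
        mat t t (\<lambda>(i, j). var (sorted_list_of_set I ! i) (sorted_list_of_set J ! j))"
    proof (rule eq_matI)
      fix i j assume "i < dim_row (mat t t (\<lambda>(i, j). var (sorted_list_of_set I ! i) (sorted_list_of_set J ! j)))"
        "j < dim_col (mat t t (\<lambda>(i, j). var (sorted_list_of_set I ! i) (sorted_list_of_set J ! j)))"
      then have ij: "i < t" "j < t" by auto
      then have "sorted_list_of_set I ! i \<in> I" "sorted_list_of_set J ! j \<in> J"
        using sorted_list_of_set_remove_nth(3)[OF fin(1), of i] sorted_list_of_set_remove_nth(3)[OF fin(2), of j] I J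
        by auto
      then have "sorted_list_of_set I ! i < m" "sorted_list_of_set J ! j < n" using I J by auto
      then show "submatrix (generic_mat m n :: 'k polynomial mat) I J $$ (i, j) =
          mat t t (\<lambda>(i, j). var (sorted_list_of_set I ! i) (sorted_list_of_set J ! j)) $$ (i, j)"
        using ij I J fin sets
        by (simp add: submatrix_def generic_mat_def pick_eq_nth_sorted_list_of_set)
    qed (use sets I J in \<open>auto simp: submatrix_def generic_mat_def\<close>)
    then show ?thesis
      using ldet_eq_det[of J "sorted_list_of_set I" "var :: nat \<Rightarrow> nat \<Rightarrow> 'k polynomial"] fin I J by simp
  qed
  have dims: "dim_row (generic_mat m n :: 'k polynomial mat) = m" "dim_col (generic_mat m n :: 'k polynomial mat) = n"
    by (simp_all add: generic_mat_def)
  show ?thesis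
    unfolding minors_def dims by (rule Collect_cong) (metis det)
qed

lemma monomial_degree_add: "monomial_degree w (u + v) = monomial_degree w u + monomial_degree w v"
proof -
  have sup: "monomial_degree w u = (\<Sum>x\<in>S. int (Poly_Mapping.lookup u x) * w x)"
    if "finite S" "Poly_Mapping.keys u \<subseteq> S" for S u
    unfolding monomial_degree_def using that by (intro sum.mono_neutral_left) (auto simp: in_keys_iff)
  let ?S = "Poly_Mapping.keys u \<union> Poly_Mapping.keys v"
  have "Poly_Mapping.keys (u + v) \<subseteq> ?S" by (rule Poly_Mapping.keys_add)
  then show ?thesis
    by (simp add: sup[of ?S] lookup_add distrib_right sum.distrib)
qed

lemma monomial_degree_single: "monomial_degree w (Poly_Mapping.single v 1) = w v"
  by (simp add: monomial_degree_def)

text \<open>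
  Each monomial of a minor contains exactly one variable from each of its columns, so a weight
  that depends on the column only has the same value on all of them.
\<close>

lemma keys_ldet_var_degree:
  assumes "\<And>i j. w (i, j) = w' j"
  shows "u \<in> Poly_Mapping.keys (ldet var rs C :: 'k::field polynomial) \<Longrightarrow> monomial_degree w u = sum w' C"
proof (induction rs arbitrary: C u)
  case Nil
  then show ?case by (auto simp: monomial_degree_def split: if_splits)
next
  case (Cons r rs)
  from Cons.prems have "ldet var (r # rs) C \<noteq> (0 :: 'k polynomial)" by auto
  then have fin: "finite C" using ldet_nonzero_card by blast
  let ?t = "\<lambda>j. (-1) ^ card (C \<inter> {..<j}) * var r j * ldet var rs (C - {j}) :: 'k polynomial"
  have "Poly_Mapping.lookup (\<Sum>j\<in>C. ?t j) u \<noteq> 0" using Cons.prems by (simp add: in_keys_iff)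
  then obtain j where j: "j \<in> C" "Poly_Mapping.lookup (?t j) u \<noteq> 0"
    unfolding lookup_sum by (meson sum.not_neutral_contains_not_neutral)
  have keys: "Poly_Mapping.keys (?t j) = Poly_Mapping.keys (var r j * ldet var rs (C - {j}) :: 'k polynomial)"
    by (cases "even (card (C \<inter> {..<j}))") auto
  have "u \<in> Poly_Mapping.keys (?t j)" using j(2) by (simp only: in_keys_iff not_False_eq_True)
  then have "u \<in> Poly_Mapping.keys (var r j * ldet var rs (C - {j}) :: 'k polynomial)"
    by (simp only: keys)
  then obtain v z where vz: "u = v + z" "v \<in> Poly_Mapping.keys (var r j :: 'k polynomial)"
    "z \<in> Poly_Mapping.keys (ldet var rs (C - {j}) :: 'k polynomial)"
    using keys_mult by blast
  then have "v = Poly_Mapping.single (r, j) 1" by (simp add: var_def)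
  then have "monomial_degree w u = w (r, j) + monomial_degree w z"
    unfolding vz(1) monomial_degree_add by (simp only: monomial_degree_single)
  also have "\<dots> = w' j + sum w' (C - {j})" using Cons.IH[OF vz(3)] assms by simp
  also have "\<dots> = sum w' C" using fin j by (simp add: sum.remove)
  finally show ?case .
qed

text \<open>
  Give the first row a single nonzero entry, so that its expansion has one term, and choose the other
  rows recursively.
\<close>

lemma exists_ldet_nonzero:
  "\<lbrakk>distinct rs; finite C; card C = length rs\<rbrakk> \<Longrightarrow> \<exists>x. ldet (\<lambda>i j. x (i, j) :: 'k::field) rs C \<noteq> 0"
proof (induction rs arbitrary: C)
  case (Cons r rs)
  then obtain c where c: "c \<in> C" by fastforce
  then have "card (C - {c}) = length rs" using Cons.prems by simp
  then obtain x where x: "ldet (\<lambda>i j. x (i, j) :: 'k) rs (C - {c}) \<noteq> 0"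
    using Cons.IH[of "C - {c}"] Cons.prems by auto
  define x' where "x' = (\<lambda>(i, j). if i = r then (if j = c then 1 else 0) else x (i, j))"
  have same: "ldet (\<lambda>i j. x' (i, j)) rs (C - {c}) = ldet (\<lambda>i j. x (i, j)) rs (C - {c})"
    by (rule ldet_cong) (use Cons.prems in \<open>auto simp: x'_def\<close>)
  have "ldet (\<lambda>i j. x' (i, j)) (r # rs) C =
      (\<Sum>j\<in>C. if j = c then (-1) ^ card (C \<inter> {..<c}) * ldet (\<lambda>i j. x' (i, j)) rs (C - {c}) else 0)"
    by (auto simp: x'_def intro!: sum.cong)
  also have "\<dots> = (-1) ^ card (C \<inter> {..<c}) * ldet (\<lambda>i j. x (i, j)) rs (C - {c})"
    using Cons.prems c by (simp add: same)
  finally show ?case using x by (intro exI[of _ x']) simp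
qed auto

text \<open>
  This excludes the unspecified value of \<open>poly_degree\<close> at 0.
\<close>

lemma minor_nonzero:
  assumes "finite I" "finite J" "card I = card J"
  shows "(minor I J :: 'k::field polynomial) \<noteq> 0"
proof -
  obtain x where x: "ldet (\<lambda>i j. x (i, j) :: 'k) (sorted_list_of_set I) J \<noteq> 0"
    using exists_ldet_nonzero[of "sorted_list_of_set I" J] assms by auto
  have "eval_polynomial (\<lambda>a. a) x (minor I J) = ldet (\<lambda>i j. x (i, j)) (sorted_list_of_set I) J"
    by (simp add: eval_polynomial_ldet eval_polynomial_var)
  then show ?thesis using x eval_polynomial_zero[of "\<lambda>a. a" x] by auto
qed

lemma poly_degree_minor:
  assumes "finite I" "finite J" "card I = t" "card J = t"
  shows "poly_degree (block_degree a p q) (minor I J :: 'k::field polynomial) =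
    int t * q - int (card (J \<inter> {..<a})) * (q - p)"
proof -
  let ?w = "block_degree a p q" and ?f = "minor I J :: 'k polynomial"
  have deg: "monomial_degree ?w u = (\<Sum>j\<in>J. if j < a then p else q)" if "u \<in> Poly_Mapping.keys ?f" for u
    by (rule keys_ldet_var_degree[OF _ that]) (simp add: block_degree_def)
  have "monomial_degree ?w ` Poly_Mapping.keys ?f = (\<lambda>u. \<Sum>j\<in>J. if j < a then p else q) ` Poly_Mapping.keys ?f"
    using deg by (intro image_cong refl)
  also have "\<dots> = {\<Sum>j\<in>J. if j < a then p else q}"
    using minor_nonzero[of I J, where 'k = 'k] assms by (simp add: image_constant_conv)
  finally have "monomial_degree ?w ` Poly_Mapping.keys ?f = {\<Sum>j\<in>J. if j < a then p else q}" .
  then have "poly_degree ?w ?f = (\<Sum>j\<in>J. if j < a then p else q)" by (simp add: poly_degree_def)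
  also have "\<dots> = (\<Sum>j\<in>J. q - (if j \<in> {..<a} then q - p else 0))"
    by (intro sum.cong) auto
  also have "\<dots> = int t * q - (\<Sum>j\<in>J \<inter> {..<a}. q - p)"
    by (simp only: sum_subtractf sum.inter_restrict[OF assms(2), symmetric] sum_constant assms(4))
  finally show ?thesis by simp
qed

lemma order_ideal_card_ge: "order_ideal {C. k \<le> card (C \<inter> {..<b})}"
  by (auto simp: order_ideal_def precedes_def intro: order_trans)

text \<open>
  Laplace expansion along the first \<open>r\<close> columns, which lie among the first \<open>a\<close> columns.
\<close>

lemma minor_in_ideal_of_fewer_columns:
  fixes U :: "'k::field polynomial set"
  assumes U: "ideal U (poly_ring m n)" and I: "I \<subseteq> {..<m}" and J: "J \<subseteq> {..<n}" and card: "card I = card J"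
    and r: "r \<le> card (J \<inter> {..<a})"
    and mem: "\<And>S J'. \<lbrakk>S \<subseteq> {..<m}; card S = r; J' \<subseteq> {..<a}; card J' = r\<rbrakk> \<Longrightarrow> minor S J' \<in> U"
  shows "minor I J \<in> U"
proof -
  have fin: "finite I" "finite J" using I J finite_subset by blast+
  have "r \<le> card J" using r card_mono[OF fin(2), of "J \<inter> {..<a}"] by simp
  then obtain J1 J2 where J12: "J = J1 \<union> J2" "\<And>x y. x \<in> J1 \<Longrightarrow> y \<in> J2 \<Longrightarrow> x < y"
    "card J1 = r" "card J2 = card J - r" "\<And>b. min r (card (J \<inter> {..<b})) \<le> card (J1 \<inter> {..<b})"
    using obtain_initial_columns[OF fin(2)] by metis
  have fJ: "finite J1" "finite J2" using fin J12(1) by auto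
  have "card (J1 \<inter> {..<a}) = card J1"
    using J12(5)[of a] r J12(3) card_mono[OF fJ(1), of "J1 \<inter> {..<a}"] by auto
  then have "J1 \<inter> {..<a} = J1" using fJ by (intro card_subset_eq) auto
  then have J1a: "J1 \<subseteq> {..<a}" by auto
  have "minor I (J1 \<union> J2) = (\<Sum>S | S \<subseteq> I \<and> card S = card J1. (-1) ^ inversions S (I - S) *
      minor S J1 * minor (I - S) J2 :: 'k polynomial)"
    by (rule ldet_laplace_columns) (use fin fJ J12 card \<open>r \<le> card J\<close> in auto)
  also have "\<dots> \<in> U"
  proof (rule poly_ring_ideal_closed(4)[OF U])
    fix S assume S: "S \<in> {S. S \<subseteq> I \<and> card S = card J1}"
    have "minor S J1 \<in> U" using S I J12(3) J1a by (intro mem) auto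
    moreover have "(-1) ^ inversions S (I - S) * minor (I - S) J2 \<in> carrier (poly_ring m n :: 'k polynomial ring)"
      using I J J12(1) by (intro poly_ring_mult poly_ring_sign minor_carrier) auto
    ultimately have "((-1) ^ inversions S (I - S) * minor (I - S) J2) * minor S J1 \<in> U"
      by (rule poly_ring_ideal_closed(3)[OF U, rotated])
    then show "(-1) ^ inversions S (I - S) * minor S J1 * minor (I - S) J2 \<in> U"
      by (simp only: mult_ac)
  qed
  finally show ?thesis using J12(1) by simp
qed

text \<open>
  Laplace expansion along the first \<open>t\<close> columns.  They avoid the identity matrix, and since \<open>r \<le> t\<close> they
  include the first \<open>r\<close> columns, which are below \<open>a\<close>.
\<close>

lemma bracket_in_ideal_of_minors:
  fixes U :: "'k::field polynomial set"
  assumes U: "ideal U (poly_ring m n)" and C: "C \<subseteq> {..<n + m}" "card C = m"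
    and t: "t \<le> card (C \<inter> {..<n})" and r: "r \<le> card (C \<inter> {..<a})" and "r \<le> t"
    and mem: "\<And>S J. \<lbrakk>S \<subseteq> {..<m}; card S = t; J \<subseteq> {..<n}; card J = t; r \<le> card (J \<inter> {..<a})\<rbrakk> \<Longrightarrow> minor S J \<in> U"
  shows "ldet (augmented n) [0..<m] C \<in> U"
proof -
  have fin: "finite C" using C finite_subset by blast
  have "t \<le> card C" using t card_mono[OF fin, of "C \<inter> {..<n}"] by simp
  then obtain C1 C2 where C12: "C = C1 \<union> C2" "\<And>x y. x \<in> C1 \<Longrightarrow> y \<in> C2 \<Longrightarrow> x < y"
    "card C1 = t" "card C2 = card C - t" "\<And>b. min t (card (C \<inter> {..<b})) \<le> card (C1 \<inter> {..<b})"
    using obtain_initial_columns[OF fin] by metis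
  have fC: "finite C1" "finite C2" using fin C12(1) by auto
  have "card (C1 \<inter> {..<n}) = card C1"
    using C12(5)[of n] t C12(3) card_mono[OF fC(1), of "C1 \<inter> {..<n}"] by auto
  then have "C1 \<inter> {..<n} = C1" using fC by (intro card_subset_eq) auto
  then have C1n: "C1 \<subseteq> {..<n}" by auto
  have C1a: "r \<le> card (C1 \<inter> {..<a})" using C12(5)[of a] r \<open>r \<le> t\<close> by simp
  let ?A = "augmented n :: nat \<Rightarrow> nat \<Rightarrow> 'k polynomial" and ?s = "sorted_list_of_set"
  have "ldet ?A (?s {..<m}) (C1 \<union> C2) = (\<Sum>S | S \<subseteq> {..<m} \<and> card S = card C1.
      (-1) ^ inversions S ({..<m} - S) * ldet ?A (?s S) C1 * ldet ?A (?s ({..<m} - S)) C2)"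
    by (rule ldet_laplace_columns) (use fC C12 C \<open>t \<le> card C\<close> in auto)
  also have "\<dots> \<in> U"
  proof (rule poly_ring_ideal_closed(4)[OF U])
    fix S assume S: "S \<in> {S. S \<subseteq> {..<m} \<and> card S = card C1}"
    have "minor S C1 \<in> U" using S C1n C1a C12(3) by (intro mem) auto
    moreover have "(-1) ^ inversions S ({..<m} - S) * ldet ?A (?s ({..<m} - S)) C2 \<in> carrier (poly_ring m n)"
      by (intro poly_ring_mult poly_ring_sign ldet_carrier augmented_carrier) auto
    ultimately have "((-1) ^ inversions S ({..<m} - S) * ldet ?A (?s ({..<m} - S)) C2) * minor S C1 \<in> U"
      by (rule poly_ring_ideal_closed(3)[OF U, rotated])
    then show "(-1) ^ inversions S ({..<m} - S) * ldet ?A (?s S) C1 * ldet ?A (?s ({..<m} - S)) C2 \<in> U"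
      by (simp only: mult_ac augmented_minor[OF C1n])
  qed
  finally show ?thesis using C12(1) by (simp add: lessThan_atLeast0)
qed

text \<open>
  Each product of brackets is a multiple of the bracket of its first row.
\<close>

lemma tableau_ideal_subset:
  fixes U :: "'k::field polynomial set"
  assumes U: "ideal U (poly_ring m n)"
    and mem: "\<And>C. \<lbrakk>C \<subseteq> {..<n + m}; card C = m; C \<in> \<Omega>\<rbrakk> \<Longrightarrow> ldet (augmented n) [0..<m] C \<in> U"
  shows "tableau_ideal m n \<Omega> \<subseteq> U"
proof -
  have sub: "kspace.subspace U"
    by (rule kspace.subspaceI) (auto intro: poly_ring_ideal_closed[OF U] poly_ring_const)
  have "bracket_monomial (augmented n) m T \<in> U"
    if T: "T \<in> tableaux m (n + m) N" "hd T \<in> \<Omega>" "1 \<le> N" for T N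
  proof -
    obtain C T' where T': "T = C # T'" using T by (cases T) (auto simp: tableaux_def)
    then have "ldet (augmented n) [0..<m] C \<in> U" using T by (intro mem) (auto simp: tableaux_def)
    then have "bracket_monomial (augmented n) m T' * ldet (augmented n) [0..<m] C \<in> U"
      by (rule poly_ring_ideal_closed(3)[OF U bracket_monomial_carrier])
    then show ?thesis by (simp add: T' bracket_monomial_def mult.commute)
  qed
  then have "tableau_span m n N \<Omega> \<subseteq> U" if "1 \<le> N" for N
    unfolding tableau_span_def using sub that by (intro kspace.span_minimal) auto
  then show ?thesis by (auto simp: tableau_ideal_def)
qed

text \<open>
  Both determinantal ideals lie in the tableau ideals of their column conditions.  If \<open>r \<le> t\<close>, the
  intersection of these is generated by brackets to which \<open>bracket_in_ideal_of_minors\<close> applies;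
  otherwise \<open>r > min m a\<close> and the second ideal is zero.
\<close>

theorem minors_Int_minors_of_first_columns:
  fixes m n a t r :: nat
  assumes "a \<le> n" and rt: "r \<le> t \<or> min m a < r"
  defines "R \<equiv> poly_ring m n :: 'k::field polynomial ring"
  shows "genideal R {minor I J | I J. I \<subseteq> {..<m} \<and> card I = t \<and> J \<subseteq> {..<n} \<and> card J = t \<and> r \<le> card (J \<inter> {..<a})} =
    det_ideal R t (generic_mat m n) \<inter> det_ideal R r (generic_mat m a)"
    (is "?J = ?P \<inter> ?Q")
proof -
  interpret cring R unfolding R_def by (rule cring_poly_ring)
  have carr: "minor I J \<in> carrier R" if "I \<subseteq> {..<m}" "J \<subseteq> {..<n}" for I J
    using minor_carrier[OF that] by (simp add: R_def)
  have carrX: "minors t (generic_mat m n) \<subseteq> carrier R"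
    unfolding minors_generic_mat using carr by auto
  have carrA: "minors r (generic_mat m a) \<subseteq> carrier R"
    unfolding minors_generic_mat
  proof clarify
    fix I J assume "I \<subseteq> {..<m}" "J \<subseteq> {..<a}"
    moreover have "{..<a} \<subseteq> {..<n}" using \<open>a \<le> n\<close> by auto
    ultimately show "minor I J \<in> carrier R" by (intro carr) auto
  qed
  let ?G = "{minor I J | I J. I \<subseteq> {..<m} \<and> card I = t \<and> J \<subseteq> {..<n} \<and> card J = t \<and> r \<le> card (J \<inter> {..<a})} :: 'k polynomial set"
  have G: "?G \<subseteq> carrier R" using carr by auto
  have idJ: "ideal ?J (poly_ring m n)" using genideal_ideal[OF G] by (simp add: R_def)
  have idP: "ideal ?P (poly_ring m n)" using genideal_ideal[OF carrX] by (simp add: R_def det_ideal_def)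
  have idQ: "ideal ?Q (poly_ring m n)" using genideal_ideal[OF carrA] by (simp add: R_def det_ideal_def)
  have memJ: "minor I J \<in> ?J"
    if "I \<subseteq> {..<m}" "card I = t" "J \<subseteq> {..<n}" "card J = t" "r \<le> card (J \<inter> {..<a})" for I J
    using genideal_self[OF G] that by blast
  have memQ: "minor I J \<in> ?Q" if "I \<subseteq> {..<m}" "card I = r" "J \<subseteq> {..<a}" "card J = r" for I J
    using genideal_self[OF carrA] that unfolding det_ideal_def minors_generic_mat by blast
  have "?J \<subseteq> ?P"
    unfolding det_ideal_def by (rule subset_Idl_subset[OF carrX]) (auto simp: minors_generic_mat)
  moreover have "?J \<subseteq> ?Q"
  proof (rule genideal_minimal)
    show "ideal ?Q R" using idQ by (simp add: R_def)
    show "?G \<subseteq> ?Q"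
    proof clarify
      fix I J assume *: "I \<subseteq> {..<m}" "t = card I" "J \<subseteq> {..<n}" "card J = card I" "r \<le> card (J \<inter> {..<a})"
      show "minor I J \<in> ?Q"
        by (rule minor_in_ideal_of_fewer_columns[OF idQ *(1,3) _ *(5)]) (use * memQ in auto)
    qed
  qed
  moreover have "?P \<inter> ?Q \<subseteq> ?J"
  proof (cases "r \<le> t")
    case True
    let ?T = "{C. t \<le> card (C \<inter> {..<n})} :: nat set set" and ?A = "{C. r \<le> card (C \<inter> {..<a})} :: nat set set"
    have "?P \<subseteq> tableau_ideal m n ?T"
      unfolding det_ideal_def
    proof (rule genideal_minimal)
      show "ideal (tableau_ideal m n ?T) R" unfolding R_def by (rule ideal_tableau_ideal)
      show "minors t (generic_mat m n) \<subseteq> (tableau_ideal m n ?T :: 'k polynomial set)"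
        unfolding minors_generic_mat
      proof clarify
        fix I J :: "nat set" assume *: "I \<subseteq> {..<m}" "J \<subseteq> {..<n}" "t = card I" "card J = card I"
        show "minor I J \<in> (tableau_ideal m n {C. card I \<le> card (C \<inter> {..<n})} :: 'k polynomial set)"
        proof (rule minor_in_tableau_ideal)
          have "J \<inter> {..<n} = J" using * by auto
          then show "J \<union> (\<lambda>i. n + i) ` ({..<m} - I) \<in> {C. card I \<le> card (C \<inter> {..<n})}"
            using * minor_eq_bracket(4)[of I m J n n] by simp
        qed (use * in auto)
      qed
    qed
    moreover have "?Q \<subseteq> tableau_ideal m n ?A"
      unfolding det_ideal_def
    proof (rule genideal_minimal)
      show "ideal (tableau_ideal m n ?A) R" unfolding R_def by (rule ideal_tableau_ideal)
      show "minors r (generic_mat m a) \<subseteq> (tableau_ideal m n ?A :: 'k polynomial set)"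
        unfolding minors_generic_mat
      proof clarify
        fix I J :: "nat set" assume *: "I \<subseteq> {..<m}" "J \<subseteq> {..<a}" "r = card I" "card J = card I"
        show "minor I J \<in> (tableau_ideal m n {C. card I \<le> card (C \<inter> {..<a})} :: 'k polynomial set)"
        proof (rule minor_in_tableau_ideal)
          show Jn: "J \<subseteq> {..<n}" using * \<open>a \<le> n\<close> by auto
          have "J \<inter> {..<a} = J" using * by auto
          then show "J \<union> (\<lambda>i. n + i) ` ({..<m} - I) \<in> {C. card I \<le> card (C \<inter> {..<a})}"
            using * Jn \<open>a \<le> n\<close> minor_eq_bracket(4)[of I m J n a] by simp
        qed (use * in auto)
      qed
    qed
    moreover have "tableau_ideal m n ?T \<inter> tableau_ideal m n ?A \<subseteq> (tableau_ideal m n (?T \<inter> ?A) :: 'k polynomial set)"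
      by (rule tableau_ideal_Int) (rule order_ideal_card_ge)+
    moreover have "tableau_ideal m n (?T \<inter> ?A) \<subseteq> ?J"
    proof (rule tableau_ideal_subset[OF idJ])
      fix C assume C: "C \<subseteq> {..<n + m}" "card C = m" "C \<in> ?T \<inter> ?A"
      show "ldet (augmented n) [0..<m] C \<in> ?J"
        by (rule bracket_in_ideal_of_minors[OF idJ C(1,2) _ _ True]) (use C memJ in auto)
    qed
    ultimately show ?thesis by blast
  next
    case False
    with rt have r: "min m a < r" by simp
    have "minors r (generic_mat m a) = ({} :: 'k polynomial set)"
    proof -
      have False if "I \<subseteq> {..<m}" "card I = r" "J \<subseteq> {..<a}" "card J = r" for I J
        using card_mono[OF _ that(1)] card_mono[OF _ that(3)] that r by auto
      then show ?thesis unfolding minors_generic_mat by blast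
    qed
    then have "?Q = genideal R {}" by (simp add: det_ideal_def)
    also have "\<dots> \<subseteq> ?J" using genideal_minimal[OF genideal_ideal[OF G], of "{}"] by simp
    finally show ?thesis by blast
  qed
  ultimately show ?thesis by blast
qed

theorem corollary1p2:
  fixes m n a t :: nat and p q d r :: int
    and R :: "'k::field polynomial ring" and X A :: "'k polynomial mat"
  assumes "a \<le> n" and "p < q"
  defines "R \<equiv> poly_ring m n" and "X \<equiv> generic_mat m n" and "A \<equiv> generic_mat m a"
    and "r \<equiv> \<lceil>(of_nat t * of_int q - of_int d) / (of_int (q - p) :: real)\<rceil>"
  assumes "r \<le> int t \<or> r > int (min m a)"
  shows "det_ideal_le R (block_degree a p q) t d X = det_ideal R t X \<inter> det_ideal R (nat r) A"
proof -
  have le_iff: "int t * q - int s * (q - p) \<le> d \<longleftrightarrow> nat r \<le> s" for s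
  proof -
    have pos: "(of_int (q - p) :: real) > 0" using \<open>p < q\<close> by simp
    have "nat r \<le> s \<longleftrightarrow> r \<le> int s" by (simp add: nat_le_iff)
    also have "\<dots> \<longleftrightarrow> (of_nat t * of_int q - of_int d) / (of_int (q - p) :: real) \<le> of_nat s"
      unfolding r_def by (simp add: ceiling_le_iff)
    also have "\<dots> \<longleftrightarrow> of_nat t * of_int q - of_int d \<le> of_nat s * (of_int (q - p) :: real)"
      using pos by (rule pos_divide_le_eq)
    also have "\<dots> \<longleftrightarrow> (of_int (int t * q - d) :: real) \<le> of_int (int s * (q - p))" by simp
    also have "\<dots> \<longleftrightarrow> int t * q - d \<le> int s * (q - p)" by (simp only: of_int_le_iff)
    finally show ?thesis by linarith
  qed
  have gens: "{f \<in> minors t X. poly_degree (block_degree a p q) f \<le> d} =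
    {minor I J | I J. I \<subseteq> {..<m} \<and> card I = t \<and> J \<subseteq> {..<n} \<and> card J = t \<and> nat r \<le> card (J \<inter> {..<a})}"
  proof -
    have "poly_degree (block_degree a p q) (minor I J :: 'k polynomial) \<le> d \<longleftrightarrow> nat r \<le> card (J \<inter> {..<a})"
      if "I \<subseteq> {..<m}" "card I = t" "J \<subseteq> {..<n}" "card J = t" for I J
    proof -
      have "finite I" "finite J" using that finite_subset by blast+
      then show ?thesis using poly_degree_minor[of I J t a p q, where 'k = 'k] that le_iff by simp
    qed
    then show ?thesis unfolding X_def minors_generic_mat by blast
  qed
  have "nat r \<le> t \<or> min m a < nat r" using assms(7) by (auto simp: nat_le_iff)
  then show ?thesis
    unfolding det_ideal_le_def gens
    unfolding R_def X_def A_def by (rule minors_Int_minors_of_first_columns[OF \<open>a \<le> n\<close>])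
qed

end
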